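(* Let $g_0:\mathbb{R}^n\to\overline{\mathbb{R}}$ be proper and lsc, $h:\mathbb{R}^m\to\overline{\mathbb{R}}$ proper, lsc and nondecreasing, and let $g_i:\Xi\times\mathbb{R}^n\to\mathbb{R}$, $i=1,\dots,m$, be lsc (jointly in both arguments) with $g_i(\cdot,x)$ uniformly bounded on $\Xi$, locally uniformly in $x$. Put $G=(g_1,\dots,g_m)$, and for $\theta^\nu>0$ put $$G^\nu(\xi,x)=(g_1^\nu(\xi,x),\dots,g_m^\nu(\xi,x)),\qquad g_i^\nu(\xi,x)=\inf_{\zeta\in\Xi}\ g_i(\zeta,x)+\tfrac1{\theta^\nu}\|\zeta-\xi\|_2 .$$ Let $\mu,\mu^\nu\in\mathscr{P}(\Xi)$ with $d_{\rm BL}(\mu^\nu,\mu)\to0$, let $\alpha\ge1$, and let $$\lambda^\nu\in(0,\infty)\to0,\qquad\theta^\nu\in(0,\infty)\to0,\qquad \tfrac1{\lambda^\nu}\big(\tfrac1{\theta^\nu}d_{\rm BL}(\mu^\nu,\mu)\big)^\alpha\to0 .$$ Define $\phi(x)=g_0(x)+h(\mathbb{E}_\mu[G(\boldsymbol\xi,x)])$, $f(u,x)=g_0(x)+h(u+\mathbb{E}_\mu[G(\boldsymbol\xi,x)])+\iota_{\{0\}^m}(u)$ and $f^\nu(u,x)=g_0(x)+h(u+\mathbb{E}_{\mu^\nu}[G^\nu(\boldsymbol\xi,x)])+\tfrac1{\alpha\lambda^\nu}\|u\|_2^\alpha$, and suppose $\operatorname{argmin}\phi\ne\emptyset$. Then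 $f^\nu$ epi-converge to $f$, and: (a) $\inf f=\inf\phi$ and $\epsilon\text{-}\operatorname{argmin}f=\{0\}\times\epsilon\text{-}\operatorname{argmin}\phi$ for every $\epsilon\in[0,\infty)$; (b) $\limsup_\nu(\inf f^\nu)\le\inf f$; (c) if $\epsilon^\nu\in[0,\infty)\to\epsilon\in[0,\infty)$, then $\operatorname{LimOut}(\epsilon^\nu\text{-}\operatorname{argmin}f^\nu)\subseteq\epsilon\text{-}\operatorname{argmin}f$; (d) if $\epsilon^\nu\in[0,\infty)\to0$ and, for some infinite $N\subseteq\mathbb{N}$, points $(u^\nu,x^\nu)\in\epsilon^\nu\text{-}\operatorname{argmin}f^\nu$, $\nu\in N$, converge along $N$, then $\lim_{\nu\in N}(\inf f^\nu)=\inf f$; (e) $\inf f^\nu\to\inf f$ if and only if the functions $f^\nu$ are tight; (f) if $\inf f^\nu\to\inf f$, then for every $x_0\in\operatorname{argmin}\phi$ there exist $\epsilon^\nu\in[0,\infty)\to0$ with $(0,x_0)\in\operatorname{LimInn}(\epsilon^\nu\text{-}\operatorname{argmin}f^\nu)$; (g) if $\inf f^\nu\to\inf f$, then there exist $\epsilon^\nu\in[0,\infty)\to0$ such that $\operatorname{Lim}(\epsilon^\nu\text{-}\operatorname{argmin}f^\nu)=\operatorname{argmin}f$.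
   Context: $\Xi\subseteq\mathbb{R}^d$ is nonempty and closed; $\mathscr{P}(\Xi)$ is the set of Borel probability measures on $\Xi$; $\overline{\mathbb{R}}=[-\infty,\infty]$; lsc = lower semicontinuous; proper = never $-\infty$ and not identically $\infty$; $h$ nondecreasing means $h(y)\ge h(z)$ whenever $y\ge z$ componentwise. $\iota_C=0$ on $C$, $\infty$ off $C$. "$g_i(\cdot,x)$ uniformly bounded on $\Xi$, locally uniformly in $x$" means: for every $x\in\mathbb{R}^n$ there are $\epsilon_x>0$, $M_x<\infty$ with $|g_i(\xi,y)|\le M_x$ for all $\xi\in\Xi$ and $\|y-x\|_2\le\epsilon_x$. $d_{\rm BL}(\mu_1,\mu_2)=\sup\big|\int_\Xi\ell\,d(\mu_1-\mu_2)\big|$ over all $\ell:\Xi\to[-1,1]$ that are $1$-Lipschitz w.r.t. $\|\cdot\|_2$. For $\psi:\mathbb{R}^k\to\overline{\mathbb{R}}$: $\operatorname{dom}\psi=\{\psi<\infty\}$, $\operatorname{argmin}\psi=\{z\in\operatorname{dom}\psi:\psi(z)=\inf\psi\}$, $\epsilon\text{-}\operatorname{argmin}\psi=\{z\in\operatorname{dom}\psi:\psi(z)\le\inf\psi+\epsilon\}$. For sets $C^\nu\subseteq\mathbb{R}^k$: $\operatorname{LimOut}C^\nu$ is the set of limits of sequences $z^\nu\in C^\nu$, $\nu\in N$, over infinite $N\subseteq\mathbb{N}$; $\operatorname{LimInn}C^\nu$ is the set of limits of sequences $z^\nu\in C^\nu$, $\nu\in\mathbb{N}$; $\operatorname{Lim}C^\nu=C$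 means both equal $C$. $\psi^\nu$ epi-converge to $\psi$ if for every $z$: $\liminf\psi^\nu(z^\nu)\ge\psi(z)$ for all $z^\nu\to z$ and $\limsup\psi^\nu(z^\nu)\le\psi(z)$ for some $z^\nu\to z$. The $\psi^\nu$ are tight if for every $\epsilon>0$ there are a compact $S_\epsilon$ and $\nu_\epsilon$ with $\inf_{S_\epsilon}\psi^\nu\le\inf\psi^\nu+\epsilon$ for all $\nu\ge\nu_\epsilon$.
   Formalization: In LimInn, z^ν ∈ C^ν is required only for all but finitely many ν; with every ν required, (f) and (g) fail, since finitely many f^ν may have inf f^ν = −∞ and hence an empty ε^ν-argmin. *)

theory Defs
  imports "HOL-Probability.Probability"
begin

section \<open>Extended real-valued functions\<close>

text \<open>Lower semicontinuity of \<open>\<psi>\<close> on \<open>S\<close>, relative to \<open>S\<close>. The codomain is kept general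
  because it is used for \<^typ>\<open>real\<close> as well as for \<^typ>\<open>ereal\<close>.\<close>

definition lsc_on :: "'a::topological_space set \<Rightarrow> ('a \<Rightarrow> 'b::linorder) \<Rightarrow> bool" where
  "lsc_on S \<psi> \<longleftrightarrow> (\<forall>z\<in>S. \<forall>c<\<psi> z. eventually (\<lambda>y. c < \<psi> y) (at z within S))"

definition proper :: "('a \<Rightarrow> ereal) \<Rightarrow> bool" where
  "proper \<psi> \<longleftrightarrow> (\<forall>z. \<psi> z \<noteq> -\<infinity>) \<and> (\<exists>z. \<psi> z \<noteq> \<infinity>)"

definition iota :: "'a set \<Rightarrow> 'a \<Rightarrow> ereal" where
  "iota C u = (if u \<in> C then 0 else \<infinity>)"

definition domain :: "('a \<Rightarrow> ereal) \<Rightarrow> 'a set" where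
  "domain \<psi> = {z. \<psi> z < \<infinity>}"

definition argmin :: "('a \<Rightarrow> ereal) \<Rightarrow> 'a set" where
  "argmin \<psi> = {z \<in> domain \<psi>. \<psi> z = (INF y. \<psi> y)}"

definition eps_argmin :: "real \<Rightarrow> ('a \<Rightarrow> ereal) \<Rightarrow> 'a set" where
  "eps_argmin \<epsilon> \<psi> = {z \<in> domain \<psi>. \<psi> z \<le> (INF y. \<psi> y) + ereal \<epsilon>}"

section \<open>Variational convergence\<close>

text \<open>The filter describing \<open>\<nu> \<rightarrow> \<infinity>\<close> along an (infinite) index set \<open>N\<close>.\<close>

abbreviation along :: "nat set \<Rightarrow> nat filter" where
  "along N \<equiv> inf sequentially (principal N)"

definition LimOut :: "(nat \<Rightarrow> 'a::topological_space set) \<Rightarrow> 'a set" where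
  "LimOut C = {l. \<exists>N z. infinite N \<and> (\<forall>\<nu>\<in>N. z \<nu> \<in> C \<nu>) \<and> (z \<longlongrightarrow> l) (along N)}"

text \<open>As is standard for the inner limit in the sense of Painleve and Kuratowski, the sequence is
  required to lie in \<open>C \<nu>\<close> for all but finitely many \<open>\<nu>\<close> only: finitely many sets
  \<open>C \<nu>\<close>, which may be empty, do not affect the limit.\<close>

definition LimInn :: "(nat \<Rightarrow> 'a::topological_space set) \<Rightarrow> 'a set" where
  "LimInn C = {l. \<exists>z. eventually (\<lambda>\<nu>. z \<nu> \<in> C \<nu>) sequentially \<and> z \<longlonglongrightarrow> l}"

definition set_Lim :: "(nat \<Rightarrow> 'a::topological_space set) \<Rightarrow> 'a set \<Rightarrow> bool" where
  "set_Lim C D \<longleftrightarrow> LimOut C = D \<and> LimInn C = D"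

definition epi_converges ::
  "(nat \<Rightarrow> 'a::topological_space \<Rightarrow> ereal) \<Rightarrow> ('a \<Rightarrow> ereal) \<Rightarrow> bool" where
  "epi_converges \<psi>s \<psi> \<longleftrightarrow>
    (\<forall>z. (\<forall>w. w \<longlonglongrightarrow> z \<longrightarrow> liminf (\<lambda>\<nu>. \<psi>s \<nu> (w \<nu>)) \<ge> \<psi> z) \<and>
         (\<exists>w. w \<longlonglongrightarrow> z \<and> limsup (\<lambda>\<nu>. \<psi>s \<nu> (w \<nu>)) \<le> \<psi> z))"

definition tight_functions :: "(nat \<Rightarrow> 'a::topological_space \<Rightarrow> ereal) \<Rightarrow> bool" where
  "tight_functions \<psi>s \<longleftrightarrow>
    (\<forall>\<epsilon>::real. \<epsilon> > 0 \<longrightarrow> (\<exists>S \<nu>0. compact S \<and>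
       (\<forall>\<nu>\<ge>\<nu>0. (INF z\<in>S. \<psi>s \<nu> z) \<le> (INF z. \<psi>s \<nu> z) + ereal \<epsilon>)))"

section \<open>Probability measures on a closed set\<close>

text \<open>Borel probability measures on \<open>\<Xi>\<close>; the underlying space of such a measure is
  \<open>\<Xi>\<close> itself.\<close>

abbreviation prob_measures :: "'a::topological_space set \<Rightarrow> 'a measure set" where
  "prob_measures \<Xi> \<equiv> space (prob_algebra (restrict_space borel \<Xi>))"

text \<open>For probability measures on \<open>\<Xi>\<close> the supremum is over a nonempty set bounded by \<open>2\<close>.\<close>

definition d_BL :: "'a::metric_space set \<Rightarrow> 'a measure \<Rightarrow> 'a measure \<Rightarrow> real" where
  "d_BL \<Xi> \<mu>1 \<mu>2 =
    (SUP l \<in> {l. 1-lipschitz_on \<Xi> l \<and> l ` \<Xi> \<subseteq> {-1..1}}.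
       \<bar>(\<integral>\<xi>. l \<xi> \<partial>\<mu>1) - (\<integral>\<xi>. l \<xi> \<partial>\<mu>2)\<bar>)"

section \<open>The integrands\<close>

definition locally_unif_bounded ::
  "'a set \<Rightarrow> ('a \<Rightarrow> 'b::real_normed_vector \<Rightarrow> real) \<Rightarrow> bool" where
  "locally_unif_bounded \<Xi> g \<longleftrightarrow>
    (\<forall>x. \<exists>\<epsilon>>0. \<exists>M. \<forall>\<xi>\<in>\<Xi>. \<forall>y. norm (y - x) \<le> \<epsilon> \<longrightarrow> \<bar>g \<xi> y\<bar> \<le> M)"

text \<open>The infimum is taken in \<^typ>\<open>real\<close>; it is a genuine infimum as soon as
  \<open>\<Xi>\<close> is nonempty, \<open>g\<close> is bounded below on \<open>\<Xi>\<close> for fixed \<open>x\<close>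
  and \<open>\<theta> > 0\<close>.\<close>

definition lip_reg ::
  "'a::real_normed_vector set \<Rightarrow> real \<Rightarrow> ('a \<Rightarrow> 'b \<Rightarrow> real) \<Rightarrow> 'a \<Rightarrow> 'b \<Rightarrow> real" where
  "lip_reg \<Xi> \<theta> g \<xi> x = (INF \<zeta>\<in>\<Xi>. g \<zeta> x + 1 / \<theta> * norm (\<zeta> - \<xi>))"

end

theory Submission
  imports Defs
begin

text \<open>
  The regularized integrand is Lipschitz in \<open>\<xi>\<close> with modulus \<open>1 / \<theta> \<nu>\<close>, so replacing
  \<open>\<mu>\<nu> \<nu>\<close> by \<open>\<mu>\<close> changes its expectation by \<open>O(1 / \<theta> \<nu> * d_BL)\<close>, which tends to \<open>0\<close>.
  Joint lower semicontinuity and dominated convergence then bound the lower limits of the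
  regularized expectations from below; as \<open>h\<close> is nondecreasing and lsc, this gives the liminf
  half of epi-convergence. For the limsup half the shift \<open>u\<close> absorbs the expectation error at a
  penalty that vanishes by the rate condition. The remaining claims hold for every
  epi-convergent sequence whose limit attains a finite infimum; for (g), a single null sequence of
  tolerances serves a countable dense set of minimizers, and inner limits are closed.
\<close>

section \<open>Consequences of epi-convergence\<close>

text \<open>The obstacle is that \<open>h\<close> is merely lsc and monotone, so it may jump to
  \<infinity>: an arbitrarily small expectation error can make \<open>h\<close> infinite next to a
  feasible point, and \<open>u = 0\<close> need not give a recovery sequence. Shifting by the exact
  difference of the regularized expectations under the limiting and the approximating measure puts
  the argument of \<open>h\<close> componentwise below the limiting expectation, where monotonicity
  alone suffices. In the other direction the integrands are only lsc in \<open>x\<close>, so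
  expectations at moving points need not converge; coordinatewise lower bounds are all there is, and
  minima with the limit turn them into a convergent sequence to which lower semicontinuity of
  \<open>h\<close> applies. The regularization has a second use: as a pointwise approximation by
  Lipschitz functions it shows that the original integrands are Borel in \<xi>. That the scaled
  distance itself vanishes is extracted from the rate condition, because the penalty parameter tends
  to 0.\<close>

lemma along_le_sequentially: "along N \<le> sequentially"
  by simp

lemma along_neq_bot:
  assumes "infinite N"
  shows "along N \<noteq> bot"
proof
  assume "along N = bot"
  then have "eventually (\<lambda>\<nu>. \<nu> \<notin> N) sequentially"
    by (simp add: trivial_limit_def eventually_inf_principal)
  then obtain k where "\<And>\<nu>. \<nu> \<ge> k \<Longrightarrow> \<nu> \<notin> N"
    by (auto simp: eventually_sequentially)
  then have "N \<subseteq> {..<k}"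
    by (metis lessThan_iff not_le subsetI)
  with assms show False
    using finite_subset by blast
qed

text \<open>Connects two descriptions of a subsequence: compactness delivers an index map, while
  \<open>epi_lower_along\<close> expects an index set. One direction rests on
  \<open>n \<le> r n\<close>, the other on monotonicity of \<open>r\<close>.\<close>

lemma along_range:
  assumes "strict_mono (r :: nat \<Rightarrow> nat)"
  shows "along (range r) = filtermap r sequentially"
proof (rule filter_eqI)
  fix P
  show "eventually P (along (range r)) \<longleftrightarrow> eventually P (filtermap r sequentially)"
  proof
    assume "eventually P (along (range r))"
    then obtain k where k: "\<And>n. n \<ge> k \<Longrightarrow> n \<in> range r \<Longrightarrow> P n"
      by (auto simp: eventually_inf_principal eventually_sequentially)
    have "P (r n)" if "n \<ge> k" for n
      using k[of "r n"] that seq_suble[OF assms, of n] by simp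
    then show "eventually P (filtermap r sequentially)"
      by (auto simp: eventually_filtermap eventually_sequentially)
  next
    assume "eventually P (filtermap r sequentially)"
    then obtain k where k: "\<And>n. n \<ge> k \<Longrightarrow> P (r n)"
      by (auto simp: eventually_filtermap eventually_sequentially)
    have "P n" if "n \<ge> r k" "n \<in> range r" for n
      using that k assms by (auto simp: strict_mono_less_eq)
    then show "eventually P (along (range r))"
      by (auto simp: eventually_inf_principal eventually_sequentially)
  qed
qed

lemma epi_lower_along:
  assumes epi: "epi_converges fs f" and z: "(z \<longlongrightarrow> l) (along N)" and c: "c < f l"
  shows "eventually (\<lambda>\<nu>. c < fs \<nu> (z \<nu>)) (along N)"
proof -
  \<comment> \<open>Epi-convergence speaks of full sequences only; filling the gaps off
    \<open>N\<close> with the limit \<open>l\<close> keeps the convergence.\<close>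
  define w where "w \<nu> = (if \<nu> \<in> N then z \<nu> else l)" for \<nu>
  have "w \<longlonglongrightarrow> l"
    unfolding w_def
    by (rule topological_tendstoI)
       (use topological_tendstoD[OF z] in \<open>force simp: eventually_inf_principal elim!: eventually_mono\<close>)
  with epi have "f l \<le> liminf (\<lambda>\<nu>. fs \<nu> (w \<nu>))"
    by (auto simp: epi_converges_def)
  with c have "eventually (\<lambda>\<nu>. c < fs \<nu> (w \<nu>)) sequentially"
    by (auto simp: le_Liminf_iff)
  then show ?thesis
    by (auto simp: eventually_inf_principal w_def elim!: eventually_mono)
qed

lemma epi_recovery:
  assumes "epi_converges fs f"
  obtains w where "w \<longlonglongrightarrow> z" "\<And>c. f z < c \<Longrightarrow> eventually (\<lambda>\<nu>. fs \<nu> (w \<nu>) < c) sequentially"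
proof -
  obtain w where "w \<longlonglongrightarrow> z" "limsup (\<lambda>\<nu>. fs \<nu> (w \<nu>)) \<le> f z"
    using assms by (auto simp: epi_converges_def)
  with that show thesis
    by (auto simp: Limsup_le_iff)
qed

lemma epi_limsup_inf_le:
  assumes "epi_converges fs f"
  shows "limsup (\<lambda>\<nu>. INF z. fs \<nu> z) \<le> (INF z. f z)"
proof (rule INF_greatest)
  fix z
  obtain w where "limsup (\<lambda>\<nu>. fs \<nu> (w \<nu>)) \<le> f z"
    using assms by (auto simp: epi_converges_def)
  moreover have "limsup (\<lambda>\<nu>. INF z. fs \<nu> z) \<le> limsup (\<lambda>\<nu>. fs \<nu> (w \<nu>))"
    by (intro Limsup_mono always_eventually) (simp add: INF_lower)
  ultimately show "limsup (\<lambda>\<nu>. INF z. fs \<nu> z) \<le> f z"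
    by simp
qed

lemma epi_inf_upper:
  assumes "epi_converges fs f" "(INF z. f z) < c"
  shows "eventually (\<lambda>\<nu>. (INF z. fs \<nu> z) < c) sequentially"
  using epi_limsup_inf_le[OF assms(1)] assms(2) by (auto simp: Limsup_le_iff)

text \<open>Values along the sequence stay below infimum plus tolerance, whose upper limit is at
  most \<open>m + \<epsilon>\<close>, yet they eventually exceed every
  \<open>c < f l\<close>.\<close>

lemma epi_LimOut_eps_argmin:
  assumes epi: "epi_converges fs f" and fin: "(INF z. f z) = ereal m"
    and e: "\<epsilon>s \<longlonglongrightarrow> \<epsilon>"
  shows "LimOut (\<lambda>\<nu>. eps_argmin (\<epsilon>s \<nu>) (fs \<nu>)) \<subseteq> eps_argmin \<epsilon> f"
proof
  fix l assume "l \<in> LimOut (\<lambda>\<nu>. eps_argmin (\<epsilon>s \<nu>) (fs \<nu>))"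
  then obtain N z where N: "infinite N" and zN: "\<And>\<nu>. \<nu> \<in> N \<Longrightarrow> z \<nu> \<in> eps_argmin (\<epsilon>s \<nu>) (fs \<nu>)"
    and z: "(z \<longlongrightarrow> l) (along N)"
    by (auto simp: LimOut_def)
  have "f l \<le> ereal (m + \<epsilon>)"
  proof (rule ccontr)
    assume "\<not> f l \<le> ereal (m + \<epsilon>)"
    then obtain c where c: "m + \<epsilon> < c" "ereal c < f l"
      using ereal_dense2[of "ereal (m + \<epsilon>)" "f l"] by (auto simp: not_le)
    \<comment> \<open>The room between \<open>m + \<epsilon>\<close> and \<open>c\<close> is shared
      equally by the error of the infimum and that of the tolerance.\<close>
    define d where "d = (c - m - \<epsilon>) / 2"
    have d: "d > 0" using c by (simp add: d_def)
    have "eventually (\<lambda>\<nu>. (INF z. fs \<nu> z) < ereal (m + d)) (along N)"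
      using epi_inf_upper[OF epi, of "ereal (m + d)"] fin d filter_leD[OF along_le_sequentially]
      by simp
    moreover have "eventually (\<lambda>\<nu>. \<epsilon>s \<nu> < \<epsilon> + d) (along N)"
      using order_tendstoD(2)[OF e, of "\<epsilon> + d"] d filter_leD[OF along_le_sequentially] by simp
    moreover have "eventually (\<lambda>\<nu>. ereal c < fs \<nu> (z \<nu>)) (along N)"
      by (rule epi_lower_along[OF epi z c(2)])
    moreover have "eventually (\<lambda>\<nu>. \<nu> \<in> N) (along N)"
      by (simp add: eventually_inf_principal)
    ultimately have "eventually (\<lambda>\<nu>. False) (along N)"
    proof eventually_elim
      case (elim \<nu>)
      have "fs \<nu> (z \<nu>) \<le> (INF z. fs \<nu> z) + ereal (\<epsilon>s \<nu>)"
        using zN[OF elim(4)] by (simp add: eps_argmin_def)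
      also have "\<dots> \<le> ereal (m + d) + ereal (\<epsilon> + d)"
        using elim by (intro add_mono) auto
      also have "\<dots> = ereal c"
        by (simp add: d_def field_simps)
      finally show False using elim(3) by simp
    qed
    then show False
      using along_neq_bot[OF N] by (simp add: trivial_limit_def)
  qed
  then show "l \<in> eps_argmin \<epsilon> f"
    using fin by (auto simp: eps_argmin_def domain_def)
qed

text \<open>The upper half is general. For the lower half, \<open>f l\<close> is at least
  \<open>m\<close>, which lifts the values of the near-minimizers, and these exceed the infima by a
  vanishing tolerance only.\<close>

lemma epi_inf_tendsto_along:
  assumes epi: "epi_converges fs f" and fin: "(INF z. f z) = ereal m"
    and e: "\<epsilon>s \<longlonglongrightarrow> 0" and N: "infinite N"
    and zN: "\<And>\<nu>. \<nu> \<in> N \<Longrightarrow> z \<nu> \<in> eps_argmin (\<epsilon>s \<nu>) (fs \<nu>)"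
    and z: "(z \<longlongrightarrow> l) (along N)"
  shows "((\<lambda>\<nu>. INF z. fs \<nu> z) \<longlongrightarrow> (INF z. f z)) (along N)"
proof (rule order_tendstoI)
  fix c assume "(INF z. f z) < c"
  then show "eventually (\<lambda>\<nu>. (INF z. fs \<nu> z) < c) (along N)"
    using epi_inf_upper[OF epi] filter_leD[OF along_le_sequentially] by blast
next
  fix a assume "a < (INF z. f z)"
  then obtain b where b: "a < ereal b" "b < m"
    using ereal_dense2[of a "ereal m"] fin by auto
  \<comment> \<open>With half of the gap the values still exceed \<open>b + d\<close>; subtracting a
    tolerance below \<open>d\<close> leaves \<open>b\<close>.\<close>
  define d where "d = (m - b) / 2"
  have d: "d > 0" using b by (simp add: d_def)
  have "ereal m \<le> f l"
    using fin by (metis INF_lower UNIV_I)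
  moreover have "b + d < m"
    using b by (simp add: d_def field_simps)
  ultimately have "ereal (b + d) < f l"
    by (metis less_ereal.simps(1) less_le_trans)
  then have "eventually (\<lambda>\<nu>. ereal (b + d) < fs \<nu> (z \<nu>)) (along N)"
    by (rule epi_lower_along[OF epi z])
  moreover have "eventually (\<lambda>\<nu>. \<epsilon>s \<nu> < d) (along N)"
    using order_tendstoD(2)[OF e d] filter_leD[OF along_le_sequentially] by blast
  moreover have "eventually (\<lambda>\<nu>. \<nu> \<in> N) (along N)"
    by (simp add: eventually_inf_principal)
  ultimately show "eventually (\<lambda>\<nu>. a < (INF z. fs \<nu> z)) (along N)"
  proof eventually_elim
    case (elim \<nu>)
    have "ereal (b + d) < (INF z. fs \<nu> z) + ereal (\<epsilon>s \<nu>)"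
      using elim(1) zN[OF elim(3)] by (auto simp: eps_argmin_def)
    also have "\<dots> \<le> (INF z. fs \<nu> z) + ereal d"
      using elim(2) by (intro add_left_mono) auto
    finally have "ereal b < (INF z. fs \<nu> z)"
      by (cases "INF z. fs \<nu> z") auto
    with b(1) show ?case by simp
  qed
qed

text \<open>The liminf condition is uniform on compact sets: infinitely many violations would supply
  points of \<open>S\<close> with a convergent subsequence, contradicting the condition at its
  limit.\<close>

lemma epi_lower_compact:
  fixes f :: "'a::metric_space \<Rightarrow> ereal"
  assumes epi: "epi_converges fs f" and S: "compact S" and c: "c < (INF z. f z)"
  shows "eventually (\<lambda>\<nu>. c \<le> (INF z\<in>S. fs \<nu> z)) sequentially"
proof (rule ccontr)
  assume "\<not> ?thesis"
  then have "infinite {\<nu>. (INF z\<in>S. fs \<nu> z) < c}" (is "infinite ?M")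
    by (auto simp: cofinite_eq_sequentially[symmetric] eventually_cofinite not_le)
  then have r: "strict_mono (enumerate ?M)" "\<And>k. enumerate ?M k \<in> ?M"
    by (auto simp: strict_mono_enumerate dest: enumerate_in_set simp del: mem_Collect_eq)
  define r where "r = enumerate ?M"
  have "\<exists>z\<in>S. fs (r k) z < c" for k
    using r(2)[of k] by (auto simp: r_def INF_less_iff)
  then obtain y where y: "\<And>k. y k \<in> S" "\<And>k. fs (r k) (y k) < c"
    by metis
  then obtain l q where q: "strict_mono (q :: nat \<Rightarrow> nat)" "(y \<circ> q) \<longlonglongrightarrow> l"
    using S unfolding compact_def by metis
  have rq: "strict_mono (r \<circ> q)"
    using r(1) q(1) by (simp add: r_def strict_mono_o)
  \<comment> \<open>\<open>inv\<close> re-indexes the subsequence of points by \<open>\<nu>\<close>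
    itself; values off the range of \<open>r \<circ> q\<close> are arbitrary and invisible to the
    filter.\<close>
  define z where "z \<nu> = y (q (inv (r \<circ> q) \<nu>))" for \<nu>
  have z: "z ((r \<circ> q) k) = y (q k)" for k
    using inv_f_f[OF strict_mono_imp_inj_on[OF rq]] by (simp add: z_def)
  have "(z \<longlongrightarrow> l) (along (range (r \<circ> q)))"
    unfolding along_range[OF rq] filterlim_filtermap
    using q(2) by (simp add: z[unfolded o_def] o_def)
  moreover have "c < f l"
    using c by (meson INF_lower UNIV_I less_le_trans)
  ultimately have "eventually (\<lambda>\<nu>. c < fs \<nu> (z \<nu>)) (along (range (r \<circ> q)))"
    by (rule epi_lower_along[OF epi])
  then have "eventually (\<lambda>k. c < fs (r (q k)) (y (q k))) sequentially"
    unfolding along_range[OF rq] eventually_filtermap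
    by (simp add: z[unfolded o_def] o_def)
  then show False
    using y(2) by (auto simp: eventually_sequentially dest: less_asym)
qed

text \<open>A recovery sequence of a minimizer together with its limit is a compact set, and this
  one set serves every \<open>\<epsilon>\<close>. Conversely, tightness replaces the infimum over
  the whole space by one over a compact set, where \<open>epi_lower_compact\<close> applies.\<close>

lemma epi_inf_tendsto_iff_tight:
  fixes f :: "'a::heine_borel \<Rightarrow> ereal"
  assumes epi: "epi_converges fs f" and fin: "(INF z. f z) = ereal m"
    and arg: "argmin f \<noteq> {}"
  shows "(\<lambda>\<nu>. INF z. fs \<nu> z) \<longlonglongrightarrow> (INF z. f z) \<longleftrightarrow> tight_functions fs"
proof
  assume lim: "(\<lambda>\<nu>. INF z. fs \<nu> z) \<longlonglongrightarrow> (INF z. f z)"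
  obtain x where x: "f x = ereal m"
    using arg fin by (auto simp: argmin_def)
  obtain w where w: "w \<longlonglongrightarrow> x" "\<And>c. f x < c \<Longrightarrow> eventually (\<lambda>\<nu>. fs \<nu> (w \<nu>) < c) sequentially"
    using epi_recovery[OF epi] by metis
  define S where "S = insert x (range w)"
  have S: "compact S"
    unfolding S_def by (rule compact_sequence_with_limit[OF w(1)])
  show "tight_functions fs"
    unfolding tight_functions_def
  proof (intro allI impI)
    fix \<epsilon> :: real assume \<epsilon>: "\<epsilon> > 0"
    have "eventually (\<lambda>\<nu>. fs \<nu> (w \<nu>) < ereal (m + \<epsilon> / 2)) sequentially"
      using \<epsilon> x by (intro w(2)) simp
    moreover have "eventually (\<lambda>\<nu>. ereal (m - \<epsilon> / 2) < (INF z. fs \<nu> z)) sequentially"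
      using \<epsilon> fin by (intro order_tendstoD(1)[OF lim]) simp
    ultimately have "eventually (\<lambda>\<nu>. (INF z\<in>S. fs \<nu> z) \<le> (INF z. fs \<nu> z) + ereal \<epsilon>) sequentially"
    proof eventually_elim
      case (elim \<nu>)
      have "(INF z\<in>S. fs \<nu> z) \<le> fs \<nu> (w \<nu>)"
        by (rule INF_lower) (simp add: S_def)
      also have "\<dots> \<le> ereal (m + \<epsilon> / 2)"
        using elim(1) by (rule less_imp_le)
      also have "\<dots> = ereal (m - \<epsilon> / 2) + ereal \<epsilon>"
        by simp
      also have "\<dots> \<le> (INF z. fs \<nu> z) + ereal \<epsilon>"
        using elim(2) by (intro add_right_mono) simp
      finally show ?case .
    qed
    with S show "\<exists>S \<nu>0. compact S \<and> (\<forall>\<nu>\<ge>\<nu>0. (INF z\<in>S. fs \<nu> z) \<le> (INF z. fs \<nu> z) + ereal \<epsilon>)"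
      unfolding eventually_sequentially by blast
  qed
next
  assume tight: "tight_functions fs"
  show "(\<lambda>\<nu>. INF z. fs \<nu> z) \<longlonglongrightarrow> (INF z. f z)"
  proof (rule order_tendstoI)
    fix c assume "(INF z. f z) < c"
    then show "eventually (\<lambda>\<nu>. (INF z. fs \<nu> z) < c) sequentially"
      by (rule epi_inf_upper[OF epi])
  next
    fix a assume "a < (INF z. f z)"
    then obtain b where b: "a < ereal b" "b < m"
      using ereal_dense2[of a "ereal m"] fin by auto
    define d where "d = (m - b) / 2"
    have d: "d > 0" using b by (simp add: d_def)
    obtain S \<nu>0 where S: "compact S" "\<And>\<nu>. \<nu> \<ge> \<nu>0 \<Longrightarrow> (INF z\<in>S. fs \<nu> z) \<le> (INF z. fs \<nu> z) + ereal d"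
      using tight d unfolding tight_functions_def by blast
    have "eventually (\<lambda>\<nu>. ereal (b + d) \<le> (INF z\<in>S. fs \<nu> z)) sequentially"
      using b fin by (intro epi_lower_compact[OF epi S(1)]) (simp add: d_def field_simps)
    moreover have "eventually (\<lambda>\<nu>. (INF z\<in>S. fs \<nu> z) \<le> (INF z. fs \<nu> z) + ereal d) sequentially"
      using S(2) by (auto simp: eventually_sequentially)
    ultimately show "eventually (\<lambda>\<nu>. a < (INF z. fs \<nu> z)) sequentially"
    proof eventually_elim
      case (elim \<nu>)
      then have "ereal (b + d) \<le> (INF z. fs \<nu> z) + ereal d"
        by simp
      then have "ereal b \<le> (INF z. fs \<nu> z)"
        by (cases "INF z. fs \<nu> z") auto
      with b(1) show ?case by simp
    qed
  qed
qed

lemma epi_LimInn_argmin: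
  assumes epi: "epi_converges fs f" and fin: "(INF z. f z) = ereal m"
    and lim: "(\<lambda>\<nu>. INF z. fs \<nu> z) \<longlonglongrightarrow> (INF z. f z)" and x: "x \<in> argmin f"
  shows "\<exists>\<epsilon>s. (\<forall>\<nu>. \<epsilon>s \<nu> \<ge> 0) \<and> \<epsilon>s \<longlonglongrightarrow> 0 \<and> x \<in> LimInn (\<lambda>\<nu>. eps_argmin (\<epsilon>s \<nu>) (fs \<nu>))"
proof -
  have fx: "f x = ereal m"
    using x fin by (auto simp: argmin_def)
  obtain w where w: "w \<longlonglongrightarrow> x" "\<And>c. f x < c \<Longrightarrow> eventually (\<lambda>\<nu>. fs \<nu> (w \<nu>) < c) sequentially"
    using epi_recovery[OF epi] by metis
  \<comment> \<open>The tolerance is exactly the excess of the recovery sequence over the infimum.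
    \<open>max 0\<close> gives nonnegativity at once; the default 0 of \<open>real_of_ereal\<close>
    at infinite values concerns finitely many \<open>\<nu>\<close> only, by
    \<open>ev\<close>.\<close>
  define e where "e \<nu> = max 0 (real_of_ereal (fs \<nu> (w \<nu>) - (INF z. fs \<nu> z)))" for \<nu>
  have ev: "eventually (\<lambda>\<nu>. fs \<nu> (w \<nu>) < ereal (m + d) \<and> ereal (m - d) < (INF z. fs \<nu> z)) sequentially"
    if "d > 0" for d
    using that fin fx by (intro eventually_conj w(2) order_tendstoD(1)[OF lim]) auto
  have "e \<longlonglongrightarrow> 0"
  proof (rule order_tendstoI)
    fix a :: real assume "a < 0"
    then show "eventually (\<lambda>\<nu>. a < e \<nu>) sequentially"
      by (intro always_eventually) (auto simp: e_def less_max_iff_disj)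
  next
    fix a :: real assume a: "0 < a"
    show "eventually (\<lambda>\<nu>. e \<nu> < a) sequentially"
      using ev[of "a / 2"] a
    proof (simp, elim eventually_mono)
      fix \<nu> assume "fs \<nu> (w \<nu>) < ereal (m + a / 2) \<and> ereal (m - a / 2) < (INF z. fs \<nu> z)"
      moreover have "(INF z. fs \<nu> z) \<le> fs \<nu> (w \<nu>)"
        by (rule INF_lower) simp
      ultimately show "e \<nu> < a"
        using a by (cases "INF z. fs \<nu> z"; cases "fs \<nu> (w \<nu>)") (auto simp: e_def)
    qed
  qed
  moreover have "eventually (\<lambda>\<nu>. w \<nu> \<in> eps_argmin (e \<nu>) (fs \<nu>)) sequentially"
    using ev[OF zero_less_one]
  proof eventually_elim
    case (elim \<nu>)
    moreover have "(INF z. fs \<nu> z) \<le> fs \<nu> (w \<nu>)"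
      by (rule INF_lower) simp
    ultimately show ?case
      by (cases "INF z. fs \<nu> z"; cases "fs \<nu> (w \<nu>)")
         (auto simp: e_def eps_argmin_def domain_def)
  qed
  ultimately show ?thesis
    using w(1) by (intro exI[of _ e]) (auto simp: LimInn_def e_def)
qed

section \<open>Inner limits in metric spaces\<close>

lemma LimInn_iff:
  fixes C :: "nat \<Rightarrow> 'a::metric_space set"
  shows "l \<in> LimInn C \<longleftrightarrow> (\<forall>e>0. eventually (\<lambda>\<nu>. \<exists>z\<in>C \<nu>. dist z l < e) sequentially)"
proof
  assume "l \<in> LimInn C"
  then obtain z where z: "eventually (\<lambda>\<nu>. z \<nu> \<in> C \<nu>) sequentially" "z \<longlonglongrightarrow> l"
    by (auto simp: LimInn_def)
  show "\<forall>e>0. eventually (\<lambda>\<nu>. \<exists>z\<in>C \<nu>. dist z l < e) sequentially"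
  proof (intro allI impI)
    fix e :: real assume "e > 0"
    from tendstoD[OF z(2) this] z(1)
    show "eventually (\<lambda>\<nu>. \<exists>z\<in>C \<nu>. dist z l < e) sequentially"
      by eventually_elim blast
  qed
next
  assume *: "\<forall>e>0. eventually (\<lambda>\<nu>. \<exists>z\<in>C \<nu>. dist z l < e) sequentially"
  \<comment> \<open>The distance to \<open>C \<nu>\<close> need not be attained, hence the vanishing
    slack; empty \<open>C \<nu>\<close>, where the choice is arbitrary, occur only finitely
    often.\<close>
  define z where "z \<nu> = (SOME z. z \<in> C \<nu> \<and> dist l z < infdist l (C \<nu>) + inverse (real (Suc \<nu>)))" for \<nu>
  have z: "z \<nu> \<in> C \<nu> \<and> dist l (z \<nu>) < infdist l (C \<nu>) + inverse (real (Suc \<nu>))" if "C \<nu> \<noteq> {}" for \<nu>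
  proof -
    have "\<exists>y\<in>C \<nu>. dist l y < infdist l (C \<nu>) + inverse (real (Suc \<nu>))"
    proof -
      have "(INF y\<in>C \<nu>. dist l y) < infdist l (C \<nu>) + inverse (real (Suc \<nu>))"
        using that by (simp add: infdist_notempty)
      then show ?thesis
        using that by (subst (asm) cINF_less_iff) (auto intro!: bdd_belowI2[of _ 0])
    qed
    then have "\<exists>y. y \<in> C \<nu> \<and> dist l y < infdist l (C \<nu>) + inverse (real (Suc \<nu>))"
      by blast
    then show ?thesis
      unfolding z_def by (rule someI_ex)
  qed
  have ne: "eventually (\<lambda>\<nu>. C \<nu> \<noteq> {}) sequentially"
    using *[rule_format, OF zero_less_one] by eventually_elim blast
  have "(\<lambda>\<nu>. infdist l (C \<nu>)) \<longlonglongrightarrow> 0"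
  proof (rule tendstoI)
    fix e :: real assume "e > 0"
    from *[rule_format, OF this]
    show "eventually (\<lambda>\<nu>. dist (infdist l (C \<nu>)) 0 < e) sequentially"
      by eventually_elim (auto simp: infdist_nonneg dist_commute intro: le_less_trans[OF infdist_le])
  qed
  then have "(\<lambda>\<nu>. infdist l (C \<nu>) + inverse (real (Suc \<nu>))) \<longlonglongrightarrow> 0 + 0"
    by (intro tendsto_add LIMSEQ_inverse_real_of_nat)
  moreover have "eventually (\<lambda>\<nu>. dist (z \<nu>) l \<le> infdist l (C \<nu>) + inverse (real (Suc \<nu>))) sequentially"
    using ne by eventually_elim (use z in \<open>force simp: dist_commute\<close>)
  ultimately have "(\<lambda>\<nu>. dist (z \<nu>) l) \<longlonglongrightarrow> 0"
    by (intro Lim_null_comparison[of "\<lambda>\<nu>. dist (z \<nu>) l"]) simp_all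
  then have "z \<longlonglongrightarrow> l"
    by (rule iffD2[OF tendsto_dist_iff])
  moreover have "eventually (\<lambda>\<nu>. z \<nu> \<in> C \<nu>) sequentially"
    using ne by eventually_elim (use z in blast)
  ultimately show "l \<in> LimInn C"
    by (auto simp: LimInn_def)
qed

text \<open>With the tolerance quantified in front, as in \<open>LimInn_iff\<close>, no diagonal
  sequence has to be built.\<close>

lemma closed_LimInn:
  fixes C :: "nat \<Rightarrow> 'a::metric_space set"
  shows "closed (LimInn C)"
proof -
  have "l \<in> LimInn C" if l: "l \<in> closure (LimInn C)" for l
    unfolding LimInn_iff
  proof (intro allI impI)
    fix e :: real assume e: "e > 0"
    then obtain y where y: "y \<in> LimInn C" "dist l y < e / 2"
      using closure_approachableD[OF l, of "e / 2"] by auto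
    then have "eventually (\<lambda>\<nu>. \<exists>z\<in>C \<nu>. dist z y < e / 2) sequentially"
      using e y(1)[unfolded LimInn_iff, rule_format, of "e / 2"] by simp
    then show "eventually (\<lambda>\<nu>. \<exists>z\<in>C \<nu>. dist z l < e) sequentially"
    proof eventually_elim
      case (elim \<nu>)
      then obtain z where "z \<in> C \<nu>" "dist z y < e / 2" by blast
      then show ?case
        using dist_triangle_half_l[of z y e l] y(2) by auto
    qed
  qed
  then show ?thesis
    by (metis closure_subset closure_eq subsetI subset_antisym)
qed

lemma LimInn_subset_LimOut: "LimInn C \<subseteq> LimOut C"
proof
  fix l assume "l \<in> LimInn C"
  then obtain z where z: "eventually (\<lambda>\<nu>. z \<nu> \<in> C \<nu>) sequentially" "z \<longlonglongrightarrow> l"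
    by (auto simp: LimInn_def)
  then obtain k where k: "\<And>\<nu>. \<nu> \<ge> k \<Longrightarrow> z \<nu> \<in> C \<nu>"
    by (auto simp: eventually_sequentially)
  have "(z \<longlongrightarrow> l) (along {k..})"
    by (rule tendsto_mono[OF along_le_sequentially z(2)])
  with k show "l \<in> LimOut C"
    unfolding LimOut_def by (intro CollectI exI[of _ "{k..}"] exI[of _ z]) (auto simp: infinite_Ici)
qed

lemma LimInn_mono:
  assumes "eventually (\<lambda>\<nu>. C \<nu> \<subseteq> D \<nu>) sequentially"
  shows "LimInn C \<subseteq> LimInn D"
proof
  fix l assume "l \<in> LimInn C"
  then obtain z where z: "eventually (\<lambda>\<nu>. z \<nu> \<in> C \<nu>) sequentially" "z \<longlonglongrightarrow> l"
    by (auto simp: LimInn_def)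
  have "eventually (\<lambda>\<nu>. z \<nu> \<in> D \<nu>) sequentially"
    using z(1) assms by eventually_elim blast
  with z(2) show "l \<in> LimInn D"
    by (auto simp: LimInn_def)
qed

lemma eps_argmin_mono: "d \<le> e \<Longrightarrow> eps_argmin d f \<subseteq> eps_argmin e f"
  unfolding eps_argmin_def using add_left_mono[of "ereal d" "ereal e" "INF y. f y"]
  by (auto intro: order_trans)

lemma eps_argmin_zero: "eps_argmin 0 f = argmin f"
  by (auto simp: eps_argmin_def argmin_def zero_ereal_def[symmetric] INF_lower antisym)

text \<open>The supremum of the given sequences need not be null or even finite. Truncating the one
  with index \<open>k\<close> at \<open>1 / (k + 1)\<close> makes all but finitely many uniformly
  small, and for each fixed \<open>k\<close> the truncation is eventually inactive.\<close>

lemma null_sequence_dominating: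
  fixes e :: "nat \<Rightarrow> nat \<Rightarrow> real"
  assumes nonneg: "\<And>k \<nu>. e k \<nu> \<ge> 0" and null: "\<And>k. e k \<longlonglongrightarrow> 0"
  obtains \<epsilon>s where "\<And>\<nu>. \<epsilon>s \<nu> \<ge> 0" "\<epsilon>s \<longlonglongrightarrow> 0" "\<And>k. eventually (\<lambda>\<nu>. e k \<nu> \<le> \<epsilon>s \<nu>) sequentially"
proof -
  define m where "m k \<nu> = min (e k \<nu>) (inverse (real (Suc k)))" for k \<nu>
  define s where "s \<nu> = (SUP k. m k \<nu>)" for \<nu>
  have m_le: "m k \<nu> \<le> inverse (real (Suc k))" for k \<nu>
    by (simp add: m_def)
  have inv_le: "inverse (real (Suc k)) \<le> inverse (real (Suc j))" if "j \<le> k" for j k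
    using that by (intro le_imp_inverse_le) auto
  have bdd: "bdd_above (range (\<lambda>k. m k \<nu>))" for \<nu>
  proof (rule bdd_aboveI2)
    show "m k \<nu> \<le> 1" for k
      using order_trans[OF m_le inv_le[of 0 k]] by simp
  qed
  have m_s: "m k \<nu> \<le> s \<nu>" for k \<nu>
    unfolding s_def by (rule cSUP_upper[OF UNIV_I bdd])
  have "0 \<le> m 0 \<nu>" for \<nu>
    using nonneg by (simp add: m_def)
  then have s_nonneg: "0 \<le> s \<nu>" for \<nu>
    using m_s order_trans by blast
  have "s \<longlonglongrightarrow> 0"
  proof (rule order_tendstoI)
    fix a :: real assume "a < 0"
    then show "eventually (\<lambda>\<nu>. a < s \<nu>) sequentially"
      using s_nonneg by (intro always_eventually allI) (auto intro: less_le_trans)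
  next
    fix a :: real assume a: "0 < a"
    \<comment> \<open>Terms from \<open>K\<close> on are small by truncation, the finitely many
      others by convergence. The target \<open>a / 2\<close> keeps the supremum strictly below
      \<open>a\<close>.\<close>
    then obtain K where K: "inverse (real (Suc K)) < a / 2"
      using reals_Archimedean[of "a / 2"] by auto
    have "eventually (\<lambda>\<nu>. \<forall>k\<in>{..<K}. e k \<nu> < a / 2) sequentially"
      using a by (intro eventually_ball_finite ballI order_tendstoD(2)[OF null]) auto
    then show "eventually (\<lambda>\<nu>. s \<nu> < a) sequentially"
    proof eventually_elim
      case (elim \<nu>)
      have "m k \<nu> \<le> a / 2" for k
      proof (cases "k < K")
        case True
        then show ?thesis using elim[rule_format, of k] by (simp add: m_def min_le_iff_disj)
      next
        case False
        then have "inverse (real (Suc k)) \<le> inverse (real (Suc K))"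
          by (intro inv_le) simp
        with m_le[of k \<nu>] K show ?thesis by linarith
      qed
      then have "s \<nu> \<le> a / 2"
        unfolding s_def by (intro cSUP_least) auto
      with a show ?case by simp
    qed
  qed
  moreover have "eventually (\<lambda>\<nu>. e k \<nu> \<le> s \<nu>) sequentially" for k
  proof -
    have "eventually (\<lambda>\<nu>. e k \<nu> < inverse (real (Suc k))) sequentially"
      by (rule order_tendstoD(2)[OF null]) simp
    then show ?thesis
    proof eventually_elim
      case (elim \<nu>)
      then show ?case using m_s[of k \<nu>] by (simp add: m_def)
    qed
  qed
  ultimately show thesis
    using that s_nonneg by blast
qed

lemma epi_Lim_eps_argmin:
  fixes f :: "'a::{metric_space, second_countable_topology} \<Rightarrow> ereal"
  assumes epi: "epi_converges fs f" and fin: "(INF z. f z) = ereal m"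
    and arg: "argmin f \<noteq> {}"
    and lim: "(\<lambda>\<nu>. INF z. fs \<nu> z) \<longlonglongrightarrow> (INF z. f z)"
  shows "\<exists>\<epsilon>s. (\<forall>\<nu>. \<epsilon>s \<nu> \<ge> 0) \<and> \<epsilon>s \<longlonglongrightarrow> 0
    \<and> set_Lim (\<lambda>\<nu>. eps_argmin (\<epsilon>s \<nu>) (fs \<nu>)) (argmin f)"
proof -
  obtain D where D: "countable D" "D \<subseteq> argmin f" "argmin f \<subseteq> closure D"
    using separable by blast
  have D_ne: "D \<noteq> {}"
    using arg D(3) by auto
  define d where "d = from_nat_into D"
  have d: "range d = D"
    unfolding d_def by (rule range_from_nat_into[OF D_ne D(1)])
  have "\<forall>k. \<exists>\<epsilon>s. (\<forall>\<nu>. \<epsilon>s \<nu> \<ge> 0) \<and> \<epsilon>s \<longlonglongrightarrow> 0 \<and> d k \<in> LimInn (\<lambda>\<nu>. eps_argmin (\<epsilon>s \<nu>) (fs \<nu>))"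
    using epi_LimInn_argmin[OF epi fin lim] d D(2) by blast
  then obtain e where e: "\<And>k \<nu>. e k \<nu> \<ge> 0" "\<And>k. e k \<longlonglongrightarrow> 0"
      "\<And>k. d k \<in> LimInn (\<lambda>\<nu>. eps_argmin (e k \<nu>) (fs \<nu>))"
    by metis
  obtain s where s: "\<And>\<nu>. s \<nu> \<ge> 0" "s \<longlonglongrightarrow> 0" "\<And>k. eventually (\<lambda>\<nu>. e k \<nu> \<le> s \<nu>) sequentially"
    using null_sequence_dominating[of e, OF e(1,2)] by blast
  let ?C = "\<lambda>\<nu>. eps_argmin (s \<nu>) (fs \<nu>)"
  have "d k \<in> LimInn ?C" for k
  proof -
    have "eventually (\<lambda>\<nu>. eps_argmin (e k \<nu>) (fs \<nu>) \<subseteq> ?C \<nu>) sequentially"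
      using s(3)[of k] by eventually_elim (rule eps_argmin_mono)
    from LimInn_mono[OF this] e(3) show ?thesis by blast
  qed
  then have "closure D \<subseteq> LimInn ?C"
    using d by (intro closure_minimal closed_LimInn) auto
  moreover have "LimOut ?C \<subseteq> argmin f"
    using epi_LimOut_eps_argmin[OF epi fin s(2)] by (simp add: eps_argmin_zero)
  \<comment> \<open>The inclusions form a circle: \<open>argmin f\<close>, \<open>closure D\<close>,
    \<open>LimInn ?C\<close>, \<open>LimOut ?C\<close>, and back to \<open>argmin f\<close>.\<close>
  ultimately have "set_Lim ?C (argmin f)"
    using D(3) LimInn_subset_LimOut[of ?C] unfolding set_Lim_def by blast
  with s show ?thesis
    by blast
qed

section \<open>Lipschitz regularization\<close>

lemma bdd_below_lip_reg:
  assumes "\<And>\<zeta>. \<zeta> \<in> \<Xi> \<Longrightarrow> b \<le> q \<zeta> x" "\<theta> > 0"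
  shows "bdd_below ((\<lambda>\<zeta>. q \<zeta> x + 1 / \<theta> * norm (\<zeta> - \<xi>)) ` \<Xi>)"
proof (rule bdd_belowI2)
  fix \<zeta> assume "\<zeta> \<in> \<Xi>"
  then have "b \<le> q \<zeta> x" by (rule assms(1))
  moreover have "0 \<le> 1 / \<theta> * norm (\<zeta> - \<xi>)" using assms(2) by simp
  ultimately show "b \<le> q \<zeta> x + 1 / \<theta> * norm (\<zeta> - \<xi>)" by linarith
qed

lemma lip_reg_le:
  assumes "\<And>\<zeta>. \<zeta> \<in> \<Xi> \<Longrightarrow> b \<le> q \<zeta> x" "\<theta> > 0" "\<zeta> \<in> \<Xi>"
  shows "lip_reg \<Xi> \<theta> q \<xi> x \<le> q \<zeta> x + 1 / \<theta> * norm (\<zeta> - \<xi>)"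
  unfolding lip_reg_def using bdd_below_lip_reg[of \<Xi> b q x \<theta>, OF assms(1,2)] assms(3) by (rule cINF_lower)

lemma lip_reg_le_self:
  assumes "\<And>\<zeta>. \<zeta> \<in> \<Xi> \<Longrightarrow> b \<le> q \<zeta> x" "\<theta> > 0" "\<xi> \<in> \<Xi>"
  shows "lip_reg \<Xi> \<theta> q \<xi> x \<le> q \<xi> x"
  using lip_reg_le[of \<Xi> b q x \<theta> \<xi> \<xi>, OF assms] by simp

lemma lip_reg_ge:
  assumes "\<Xi> \<noteq> {}" "\<And>\<zeta>. \<zeta> \<in> \<Xi> \<Longrightarrow> c \<le> q \<zeta> x + 1 / \<theta> * norm (\<zeta> - \<xi>)"
  shows "c \<le> lip_reg \<Xi> \<theta> q \<xi> x"
  unfolding lip_reg_def using assms by (rule cINF_greatest)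

lemma abs_lip_reg_le:
  assumes "\<And>\<zeta>. \<zeta> \<in> \<Xi> \<Longrightarrow> \<bar>q \<zeta> x\<bar> \<le> M" "\<theta> > 0" "\<xi> \<in> \<Xi>"
  shows "\<bar>lip_reg \<Xi> \<theta> q \<xi> x\<bar> \<le> M"
proof -
  have b: "- M \<le> q \<zeta> x" "q \<zeta> x \<le> M" if "\<zeta> \<in> \<Xi>" for \<zeta>
    using assms(1)[OF that] by auto
  have "lip_reg \<Xi> \<theta> q \<xi> x \<le> M"
    using lip_reg_le_self[of \<Xi> "- M" q x, OF b(1) assms(2,3)] b(2)[OF assms(3)] by linarith
  moreover have "- M \<le> lip_reg \<Xi> \<theta> q \<xi> x"
  proof (rule lip_reg_ge)
    fix \<zeta> assume "\<zeta> \<in> \<Xi>"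
    moreover have "0 \<le> 1 / \<theta> * norm (\<zeta> - \<xi>)"
      using assms(2) by simp
    ultimately show "- M \<le> q \<zeta> x + 1 / \<theta> * norm (\<zeta> - \<xi>)"
      using b(1)[of \<zeta>] by linarith
  qed (use assms in auto)
  ultimately show ?thesis by linarith
qed

text \<open>For each fixed \<zeta> the expression under the infimum is Lipschitz in \<xi> with
  modulus \<open>1 / \<theta>\<close>, and an infimum bounded below inherits a common modulus,
  whatever the regularity of \<open>q\<close>.\<close>

lemma lipschitz_on_lip_reg:
  assumes "\<And>\<zeta>. \<zeta> \<in> \<Xi> \<Longrightarrow> b \<le> q \<zeta> x" "\<theta> > 0"
  shows "(1 / \<theta>)-lipschitz_on \<Xi> (\<lambda>\<xi>. lip_reg \<Xi> \<theta> q \<xi> x)"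
proof (rule lipschitz_onI)
  have *: "lip_reg \<Xi> \<theta> q \<xi> x - 1 / \<theta> * dist \<xi> \<eta> \<le> lip_reg \<Xi> \<theta> q \<eta> x"
    if "\<eta> \<in> \<Xi>" for \<xi> \<eta>
  proof (rule lip_reg_ge)
    fix \<zeta> assume \<zeta>: "\<zeta> \<in> \<Xi>"
    have "norm (\<zeta> - \<xi>) \<le> norm (\<zeta> - \<eta>) + dist \<xi> \<eta>"
      by (metis dist_commute dist_norm dist_triangle)
    then have "1 / \<theta> * norm (\<zeta> - \<xi>) \<le> 1 / \<theta> * (norm (\<zeta> - \<eta>) + dist \<xi> \<eta>)"
      using assms(2) by (intro mult_left_mono) auto
    then show "lip_reg \<Xi> \<theta> q \<xi> x - 1 / \<theta> * dist \<xi> \<eta> \<le> q \<zeta> x + 1 / \<theta> * norm (\<zeta> - \<eta>)"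
      using lip_reg_le[of \<Xi> b q x \<theta> \<zeta> \<xi>, OF assms \<zeta>] by (simp add: distrib_left)
  qed (use that in auto)
  fix \<xi> \<eta> assume "\<xi> \<in> \<Xi>" "\<eta> \<in> \<Xi>"
  then show "dist (lip_reg \<Xi> \<theta> q \<xi> x) (lip_reg \<Xi> \<theta> q \<eta> x) \<le> 1 / \<theta> * dist \<xi> \<eta>"
    using *[of \<eta> \<xi>] *[of \<xi> \<eta>] by (simp add: dist_real_def dist_commute abs_le_iff)
qed (use assms in auto)

text \<open>Candidates \<zeta> near \<xi> are handled by joint lower semicontinuity; for those
  farther away the distance penalty outgrows the local bound on \<open>q\<close> as
  \<open>\<theta> \<nu>\<close> vanishes.\<close>

lemma lip_reg_lower_limit:
  fixes \<Xi> :: "'a::real_normed_vector set" and q :: "'a \<Rightarrow> 'b::real_normed_vector \<Rightarrow> real"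
  assumes lsc: "lsc_on (\<Xi> \<times> UNIV) (\<lambda>(\<xi>, x). q \<xi> x)" and bdd: "locally_unif_bounded \<Xi> q"
    and \<theta>: "\<And>\<nu>. \<theta> \<nu> > 0" "\<theta> \<longlonglongrightarrow> 0"
    and x: "xs \<longlonglongrightarrow> x" and \<xi>: "\<xi> \<in> \<Xi>" and c: "c < q \<xi> x"
  shows "eventually (\<lambda>\<nu>. c \<le> lip_reg \<Xi> (\<theta> \<nu>) q \<xi> (xs \<nu>)) sequentially"
proof -
  have "eventually (\<lambda>(\<zeta>, y). c < q \<zeta> y) (at (\<xi>, x) within \<Xi> \<times> UNIV)"
    using lsc \<xi> c unfolding lsc_on_def by (auto simp: case_prod_beta')
  then obtain d where d: "d > 0" and
    dq: "\<And>z. z \<in> \<Xi> \<times> UNIV \<Longrightarrow> z \<noteq> (\<xi>, x) \<Longrightarrow> dist z (\<xi>, x) < d \<Longrightarrow> c < q (fst z) (snd z)"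
    by (force simp: eventually_at case_prod_beta')
  \<comment> \<open>The product distance is at most the sum of the two distances, hence
    \<open>d / 2\<close> for each. The centre is treated apart because the filter excludes
    it.\<close>
  have near: "c < q \<zeta> y" if "\<zeta> \<in> \<Xi>" "dist \<zeta> \<xi> < d / 2" "dist y x < d / 2" for \<zeta> y
  proof (cases "(\<zeta>, y) = (\<xi>, x)")
    case False
    have "dist (\<zeta>, y) (\<xi>, x) \<le> dist \<zeta> \<xi> + dist y x"
      unfolding dist_Pair_Pair by (rule sqrt_sum_squares_le_sum) auto
    with dq[of "(\<zeta>, y)"] that False show ?thesis by simp
  qed (use c in simp)
  obtain e M where e: "e > 0" and M: "\<And>\<zeta> y. \<zeta> \<in> \<Xi> \<Longrightarrow> norm (y - x) \<le> e \<Longrightarrow> \<bar>q \<zeta> y\<bar> \<le> M"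
    using bdd unfolding locally_unif_bounded_def by metis
  have "eventually (\<lambda>\<nu>. dist (xs \<nu>) x < min e (d / 2)) sequentially"
    using e d by (intro tendstoD[OF x]) simp
  \<comment> \<open>Below this threshold the penalty at distance \<open>d / 2\<close> exceeds
    \<open>\<bar>M\<bar> + \<bar>c\<bar>\<close>; the summand 1 keeps the denominator
    positive.\<close>
  moreover have "eventually (\<lambda>\<nu>. \<theta> \<nu> < (d / 2) / (1 + \<bar>M\<bar> + \<bar>c\<bar>)) sequentially"
    using d by (intro order_tendstoD(2)[OF \<theta>(2)]) (simp add: divide_pos_pos)
  ultimately show ?thesis
  proof eventually_elim
    case (elim \<nu>)
    show ?case
    proof (rule lip_reg_ge)
      fix \<zeta> assume \<zeta>: "\<zeta> \<in> \<Xi>"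
      show "c \<le> q \<zeta> (xs \<nu>) + 1 / \<theta> \<nu> * norm (\<zeta> - \<xi>)"
      proof (cases "dist \<zeta> \<xi> < d / 2")
        case True
        then have "c < q \<zeta> (xs \<nu>)"
          using near[OF \<zeta> True] elim(1) by simp
        moreover have "0 \<le> 1 / \<theta> \<nu> * norm (\<zeta> - \<xi>)"
          using \<theta>(1)[of \<nu>] by simp
        ultimately show ?thesis by linarith
      next
        case False
        have "1 + \<bar>M\<bar> + \<bar>c\<bar> \<le> 1 / \<theta> \<nu> * (d / 2)"
          using elim(2) \<theta>(1)[of \<nu>] by (simp add: field_simps)
        also have "\<dots> \<le> 1 / \<theta> \<nu> * norm (\<zeta> - \<xi>)"
          using False \<theta>(1)[of \<nu>] by (intro mult_left_mono) (auto simp: dist_norm)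
        finally have "1 + \<bar>M\<bar> + \<bar>c\<bar> \<le> 1 / \<theta> \<nu> * norm (\<zeta> - \<xi>)" .
        moreover have "\<bar>q \<zeta> (xs \<nu>)\<bar> \<le> M"
          using elim(1) by (intro M[OF \<zeta>]) (simp add: dist_norm)
        ultimately show ?thesis by linarith
      qed
    qed (use \<xi> in auto)
  qed
qed

text \<open>With \<open>x\<close> held fixed, the bound of the regularization by \<open>q\<close>
  itself supplies the upper half of the limit, which is missing for moving points.\<close>

lemma lip_reg_tendsto:
  fixes \<Xi> :: "'a::real_normed_vector set" and q :: "'a \<Rightarrow> 'b::real_normed_vector \<Rightarrow> real"
  assumes lsc: "lsc_on (\<Xi> \<times> UNIV) (\<lambda>(\<xi>, x). q \<xi> x)" and bdd: "locally_unif_bounded \<Xi> q"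
    and \<theta>: "\<And>\<nu>. \<theta> \<nu> > 0" "\<theta> \<longlonglongrightarrow> 0" and \<xi>: "\<xi> \<in> \<Xi>"
  shows "(\<lambda>\<nu>. lip_reg \<Xi> (\<theta> \<nu>) q \<xi> x) \<longlonglongrightarrow> q \<xi> x"
proof (rule order_tendstoI)
  fix c assume "c < q \<xi> x"
  then obtain c' where c': "c < c'" "c' < q \<xi> x"
    using dense by blast
  show "eventually (\<lambda>\<nu>. c < lip_reg \<Xi> (\<theta> \<nu>) q \<xi> x) sequentially"
    using lip_reg_lower_limit[OF lsc bdd \<theta> tendsto_const \<xi> c'(2)]
    by eventually_elim (use c'(1) in simp)
next
  obtain M where M: "\<And>\<zeta>. \<zeta> \<in> \<Xi> \<Longrightarrow> \<bar>q \<zeta> x\<bar> \<le> M"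
    using bdd unfolding locally_unif_bounded_def by (metis diff_self norm_zero less_imp_le)
  have "- M \<le> q \<zeta> x" if "\<zeta> \<in> \<Xi>" for \<zeta>
    using M[OF that] by linarith
  then have le: "lip_reg \<Xi> (\<theta> \<nu>) q \<xi> x \<le> q \<xi> x" for \<nu>
    by (rule lip_reg_le_self) (use \<theta> \<xi> in auto)
  fix c assume "q \<xi> x < c"
  with le show "eventually (\<lambda>\<nu>. lip_reg \<Xi> (\<theta> \<nu>) q \<xi> x < c) sequentially"
    by (intro always_eventually) (auto intro: le_less_trans)
qed

section \<open>The bounded Lipschitz distance\<close>

lemma prob_measures_iff:
  "M \<in> prob_measures \<Xi> \<longleftrightarrow> prob_space M \<and> sets M = sets (restrict_space borel \<Xi>)"
  by (auto simp: space_prob_algebra)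

lemma space_prob_measures: "M \<in> prob_measures \<Xi> \<Longrightarrow> space M = \<Xi>"
  using sets_eq_imp_space_eq[of M "restrict_space borel \<Xi>"]
  by (simp add: prob_measures_iff space_restrict_space)

lemma integrable_prob_measures:
  fixes l :: "'a::topological_space \<Rightarrow> real"
  assumes M: "M \<in> prob_measures \<Xi>" and l: "l \<in> borel_measurable (restrict_space borel \<Xi>)"
    and b: "\<And>\<xi>. \<xi> \<in> \<Xi> \<Longrightarrow> \<bar>l \<xi>\<bar> \<le> B"
  shows "integrable M l"
proof -
  interpret prob_space M using M by (simp add: prob_measures_iff)
  have "l \<in> borel_measurable M"
    using M l by (simp add: prob_measures_iff cong: measurable_cong_sets)
  then show ?thesis
    using b by (intro integrable_const_bound[of _ B]) (auto simp: space_prob_measures[OF M])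
qed

lemma abs_integral_prob_measures_le:
  fixes l :: "'a::topological_space \<Rightarrow> real"
  assumes M: "M \<in> prob_measures \<Xi>" and b: "\<And>\<xi>. \<xi> \<in> \<Xi> \<Longrightarrow> \<bar>l \<xi>\<bar> \<le> B" and B: "B \<ge> 0"
  shows "\<bar>\<integral>\<xi>. l \<xi> \<partial>M\<bar> \<le> B"
proof (cases "integrable M l")
  case True
  interpret prob_space M using M by (simp add: prob_measures_iff)
  have "\<bar>\<integral>\<xi>. l \<xi> \<partial>M\<bar> \<le> (\<integral>\<xi>. \<bar>l \<xi>\<bar> \<partial>M)"
    by (rule integral_abs_bound)
  also have "\<dots> \<le> (\<integral>\<xi>. B \<partial>M)"
    using True b by (intro integral_mono) (auto simp: space_prob_measures[OF M])
  finally show ?thesis by (simp add: prob_space)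
\<comment> \<open>A function that is not integrable has integral 0 by convention, so
  \<open>B \<ge> 0\<close> settles this case.\<close>
qed (use B in \<open>simp add: not_integrable_integral_eq\<close>)

lemma lipschitz_on_imp_measurable:
  fixes l :: "'a::metric_space \<Rightarrow> real"
  assumes "L-lipschitz_on \<Xi> l"
  shows "l \<in> borel_measurable (restrict_space borel \<Xi>)"
  using lipschitz_on_continuous_on[OF assms] by (rule borel_measurable_continuous_on_restrict)

text \<open>Dividing by \<open>K\<close>, which bounds both the modulus and the absolute value,
  turns \<open>l\<close> into an admissible test function.\<close>

lemma abs_integral_diff_le_d_BL:
  fixes l :: "'a::metric_space \<Rightarrow> real"
  assumes M: "M1 \<in> prob_measures \<Xi>" "M2 \<in> prob_measures \<Xi>"
    and lip: "K-lipschitz_on \<Xi> l" and b: "\<And>\<xi>. \<xi> \<in> \<Xi> \<Longrightarrow> \<bar>l \<xi>\<bar> \<le> K" and K: "K > 0"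
  shows "\<bar>(\<integral>\<xi>. l \<xi> \<partial>M1) - (\<integral>\<xi>. l \<xi> \<partial>M2)\<bar> \<le> K * d_BL \<Xi> M1 M2"
proof -
  let ?A = "{l. 1-lipschitz_on \<Xi> l \<and> l ` \<Xi> \<subseteq> {-1..1::real}}"
  let ?D = "\<lambda>l. \<bar>(\<integral>\<xi>. l \<xi> \<partial>M1) - (\<integral>\<xi>. l \<xi> \<partial>M2)\<bar>"
  \<comment> \<open>The supremum in \<open>d_BL\<close> is real-valued, so it dominates its members
    only once they are known to be bounded.\<close>
  have "?D l \<le> 2" if "l \<in> ?A" for l
  proof -
    have *: "\<bar>l \<xi>\<bar> \<le> 1" if "\<xi> \<in> \<Xi>" for \<xi>
      using \<open>l \<in> ?A\<close> that by (force simp: abs_le_iff)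
    show ?thesis
      using abs_integral_prob_measures_le[of M1 \<Xi> l 1, OF M(1) *]
        abs_integral_prob_measures_le[of M2 \<Xi> l 1, OF M(2) *] by simp
  qed
  then have bdd: "bdd_above (?D ` ?A)"
    by (rule bdd_aboveI2)
  have "(1 / K * K)-lipschitz_on \<Xi> (\<lambda>\<xi>. 1 / K * l \<xi>)"
    using lipschitz_on_cmult_real[OF lip, of "1 / K"] K by simp
  then have "(\<lambda>\<xi>. l \<xi> / K) \<in> ?A"
    using K b by (auto simp: abs_le_iff minus_le_iff field_simps)
  then have "?D (\<lambda>\<xi>. l \<xi> / K) \<le> d_BL \<Xi> M1 M2"
    unfolding d_BL_def using bdd by (rule cSUP_upper)
  then have "?D l / K \<le> d_BL \<Xi> M1 M2"
    using K by (simp add: diff_divide_distrib[symmetric])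
  then show ?thesis
    using K by (simp add: field_simps)
qed

lemma d_BL_nonneg:
  assumes "M1 \<in> prob_measures \<Xi>" "M2 \<in> prob_measures \<Xi>"
  shows "0 \<le> d_BL \<Xi> M1 M2"
  using abs_integral_diff_le_d_BL[OF assms, of 1 "\<lambda>_. 0"] by (simp add: lipschitz_on_def)

section \<open>Expectations of the regularized integrands\<close>

text \<open>One bound serves the limit point and a tail of the sequence, as domination arguments
  require.\<close>

lemma locally_unif_boundedE:
  fixes q :: "'a \<Rightarrow> 'b::real_normed_vector \<Rightarrow> real"
  assumes "locally_unif_bounded \<Xi> q" "xs \<longlonglongrightarrow> x"
  obtains M where "\<And>\<zeta>. \<zeta> \<in> \<Xi> \<Longrightarrow> \<bar>q \<zeta> x\<bar> \<le> M"
    "eventually (\<lambda>\<nu>. \<forall>\<zeta>\<in>\<Xi>. \<bar>q \<zeta> (xs \<nu>)\<bar> \<le> M) sequentially"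
proof -
  obtain e M where e: "e > 0" and M: "\<And>\<zeta> y. \<zeta> \<in> \<Xi> \<Longrightarrow> norm (y - x) \<le> e \<Longrightarrow> \<bar>q \<zeta> y\<bar> \<le> M"
    using assms(1) unfolding locally_unif_bounded_def by metis
  have "eventually (\<lambda>\<nu>. \<forall>\<zeta>\<in>\<Xi>. \<bar>q \<zeta> (xs \<nu>)\<bar> \<le> M) sequentially"
    using tendstoD[OF assms(2) e] by eventually_elim (auto simp: dist_norm intro: M)
  moreover have "\<bar>q \<zeta> x\<bar> \<le> M" if "\<zeta> \<in> \<Xi>" for \<zeta>
    using M[OF that, of x] e by simp
  ultimately show thesis
    using that by blast
qed

lemma lip_reg_measurable:
  fixes \<Xi> :: "'a::real_normed_vector set" and q :: "'a \<Rightarrow> 'b::real_normed_vector \<Rightarrow> real"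
  assumes "locally_unif_bounded \<Xi> q" "\<theta> > 0"
  shows "(\<lambda>\<xi>. lip_reg \<Xi> \<theta> q \<xi> x) \<in> borel_measurable (restrict_space borel \<Xi>)"
proof -
  obtain M where "\<And>\<zeta>. \<zeta> \<in> \<Xi> \<Longrightarrow> \<bar>q \<zeta> x\<bar> \<le> M"
    using locally_unif_boundedE[OF assms(1) tendsto_const[of x]] by blast
  then have "- M \<le> q \<zeta> x" if "\<zeta> \<in> \<Xi>" for \<zeta>
    using that by fastforce
  then show ?thesis
    by (intro lipschitz_on_imp_measurable[OF lipschitz_on_lip_reg[of \<Xi> "- M"]] assms(2))
qed

lemma lip_reg_integrable:
  fixes \<Xi> :: "'a::real_normed_vector set" and q :: "'a \<Rightarrow> 'b::real_normed_vector \<Rightarrow> real"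
  assumes "M \<in> prob_measures \<Xi>" "locally_unif_bounded \<Xi> q" "\<theta> > 0"
  shows "integrable M (\<lambda>\<xi>. lip_reg \<Xi> \<theta> q \<xi> x)"
proof -
  obtain B where "\<And>\<zeta>. \<zeta> \<in> \<Xi> \<Longrightarrow> \<bar>q \<zeta> x\<bar> \<le> B"
    using locally_unif_boundedE[OF assms(2) tendsto_const[of x]] by blast
  then show ?thesis
    by (intro integrable_prob_measures[OF assms(1) lip_reg_measurable[OF assms(2,3)], where B = B]
        abs_lip_reg_le assms(3))
qed

text \<open>\<open>q\<close> is the pointwise limit of its own regularizations along
  \<open>\<theta> = 1 / (k + 1)\<close>, each of them Lipschitz and hence Borel.\<close>

lemma lsc_bounded_measurable:
  fixes \<Xi> :: "'a::real_normed_vector set" and q :: "'a \<Rightarrow> 'b::real_normed_vector \<Rightarrow> real"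
  assumes lsc: "lsc_on (\<Xi> \<times> UNIV) (\<lambda>(\<xi>, x). q \<xi> x)" and bdd: "locally_unif_bounded \<Xi> q"
  shows "(\<lambda>\<xi>. q \<xi> x) \<in> borel_measurable (restrict_space borel \<Xi>)"
proof (rule borel_measurable_LIMSEQ_metric)
  fix k
  show "(\<lambda>\<xi>. lip_reg \<Xi> (inverse (real (Suc k))) q \<xi> x) \<in> borel_measurable (restrict_space borel \<Xi>)"
    by (rule lip_reg_measurable[OF bdd]) simp
next
  fix \<xi> assume "\<xi> \<in> space (restrict_space borel \<Xi>)"
  then show "(\<lambda>k. lip_reg \<Xi> (inverse (real (Suc k))) q \<xi> x) \<longlonglongrightarrow> q \<xi> x"
    by (intro lip_reg_tendsto[OF lsc bdd _ LIMSEQ_inverse_real_of_nat])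
       (auto simp: space_restrict_space)
qed

lemma lsc_bounded_integrable:
  fixes \<Xi> :: "'a::real_normed_vector set" and q :: "'a \<Rightarrow> 'b::real_normed_vector \<Rightarrow> real"
  assumes "M \<in> prob_measures \<Xi>"
    and "lsc_on (\<Xi> \<times> UNIV) (\<lambda>(\<xi>, x). q \<xi> x)" "locally_unif_bounded \<Xi> q"
  shows "integrable M (\<lambda>\<xi>. q \<xi> x)"
proof -
  obtain B where "\<And>\<zeta>. \<zeta> \<in> \<Xi> \<Longrightarrow> \<bar>q \<zeta> x\<bar> \<le> B"
    using locally_unif_boundedE[OF assms(3) tendsto_const[of x]] by blast
  then show ?thesis
    by (intro integrable_prob_measures[OF assms(1) lsc_bounded_measurable[OF assms(2,3)]])
qed

lemma integral_lip_reg_le: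
  fixes \<Xi> :: "'a::real_normed_vector set" and q :: "'a \<Rightarrow> 'b::real_normed_vector \<Rightarrow> real"
  assumes M: "M \<in> prob_measures \<Xi>"
    and lsc: "lsc_on (\<Xi> \<times> UNIV) (\<lambda>(\<xi>, x). q \<xi> x)" and bdd: "locally_unif_bounded \<Xi> q"
    and \<theta>: "\<theta> > 0"
  shows "(\<integral>\<xi>. lip_reg \<Xi> \<theta> q \<xi> x \<partial>M) \<le> (\<integral>\<xi>. q \<xi> x \<partial>M)"
proof (rule integral_mono)
  obtain B where B: "\<And>\<zeta>. \<zeta> \<in> \<Xi> \<Longrightarrow> \<bar>q \<zeta> x\<bar> \<le> B"
    using locally_unif_boundedE[OF bdd tendsto_const[of x]] by blast
  then have "- B \<le> q \<zeta> x" if "\<zeta> \<in> \<Xi>" for \<zeta>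
    using that by fastforce
  then show "lip_reg \<Xi> \<theta> q \<xi> x \<le> q \<xi> x" if "\<xi> \<in> space M" for \<xi>
    using that \<theta> by (intro lip_reg_le_self[of \<Xi> "- B"]) (auto simp: space_prob_measures[OF M])
qed (use assms in \<open>auto intro: lip_reg_integrable lsc_bounded_integrable\<close>)

lemma integral_lip_reg_lower_limit:
  fixes \<Xi> :: "'a::real_normed_vector set" and q :: "'a \<Rightarrow> 'b::real_normed_vector \<Rightarrow> real"
  assumes M: "M \<in> prob_measures \<Xi>"
    and lsc: "lsc_on (\<Xi> \<times> UNIV) (\<lambda>(\<xi>, x). q \<xi> x)" and bdd: "locally_unif_bounded \<Xi> q"
    and \<theta>: "\<And>\<nu>. \<theta> \<nu> > 0" "\<theta> \<longlonglongrightarrow> 0"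
    and x: "xs \<longlonglongrightarrow> x" and c: "c < (\<integral>\<xi>. q \<xi> x \<partial>M)"
  shows "eventually (\<lambda>\<nu>. c < (\<integral>\<xi>. lip_reg \<Xi> (\<theta> \<nu>) q \<xi> (xs \<nu>) \<partial>M)) sequentially"
proof -
  interpret prob_space M using M by (simp add: prob_measures_iff)
  obtain B where B: "\<And>\<zeta>. \<zeta> \<in> \<Xi> \<Longrightarrow> \<bar>q \<zeta> x\<bar> \<le> B"
    and evB: "eventually (\<lambda>\<nu>. \<forall>\<zeta>\<in>\<Xi>. \<bar>q \<zeta> (xs \<nu>)\<bar> \<le> B) sequentially"
    using locally_unif_boundedE[OF bdd x] by blast
  \<comment> \<open>The truncation provides a dominated sequence; only a lower limit is available for the
    regularized integrands themselves.\<close>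
  define m where "m \<nu> \<xi> = max (- B) (min (lip_reg \<Xi> (\<theta> \<nu>) q \<xi> (xs \<nu>)) (q \<xi> x))" for \<nu> \<xi>
  have sp: "space M = \<Xi>" and st: "sets M = sets (restrict_space borel \<Xi>)"
    using M by (auto simp: space_prob_measures prob_measures_iff)
  have [measurable]: "(\<lambda>\<xi>. lip_reg \<Xi> (\<theta> \<nu>) q \<xi> (xs \<nu>)) \<in> borel_measurable M" for \<nu>
    using lip_reg_integrable[OF M bdd \<theta>(1)] by (rule borel_measurable_integrable)
  have [measurable]: "(\<lambda>\<xi>. q \<xi> x) \<in> borel_measurable M"
    using lsc_bounded_integrable[OF M lsc bdd] by (rule borel_measurable_integrable)
  have [measurable]: "m \<nu> \<in> borel_measurable M" for \<nu>
    unfolding m_def by measurable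
  \<comment> \<open>Clipping at \<open>- B\<close> makes this hold for every \<open>\<nu>\<close>,
    while \<open>evB\<close> is available only from some index on. After that index the clip is
    inactive, so \<open>m\<close> lies below the regularization.\<close>
  have m_bound: "\<bar>m \<nu> \<xi>\<bar> \<le> B" if "\<xi> \<in> \<Xi>" for \<nu> \<xi>
    using B[OF that] by (auto simp: m_def)
  have m_lim: "(\<lambda>\<nu>. m \<nu> \<xi>) \<longlonglongrightarrow> q \<xi> x" if \<xi>: "\<xi> \<in> \<Xi>" for \<xi>
  proof (rule order_tendstoI)
    fix a assume "a < q \<xi> x"
    then obtain a' where a': "a < a'" "a' < q \<xi> x"
      using dense by blast
    show "eventually (\<lambda>\<nu>. a < m \<nu> \<xi>) sequentially"
      using lip_reg_lower_limit[OF lsc bdd \<theta> x \<xi> a'(2)]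
      by eventually_elim (use a' in \<open>simp add: m_def less_max_iff_disj\<close>)
  next
    fix a assume "q \<xi> x < a"
    moreover have "m \<nu> \<xi> \<le> q \<xi> x" for \<nu>
      using B[OF \<xi>] by (simp add: m_def min_le_iff_disj)
    ultimately show "eventually (\<lambda>\<nu>. m \<nu> \<xi> < a) sequentially"
      by (intro always_eventually) (auto intro: le_less_trans)
  qed
  have "(\<lambda>\<nu>. \<integral>\<xi>. m \<nu> \<xi> \<partial>M) \<longlonglongrightarrow> (\<integral>\<xi>. q \<xi> x \<partial>M)"
    by (rule integral_dominated_convergence[where w = "\<lambda>_. B"])
       (auto simp: sp m_lim m_bound)
  then have "eventually (\<lambda>\<nu>. c < (\<integral>\<xi>. m \<nu> \<xi> \<partial>M)) sequentially"
    using c by (rule order_tendstoD(1))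
  with evB show ?thesis
  proof eventually_elim
    case (elim \<nu>)
    have "(\<integral>\<xi>. m \<nu> \<xi> \<partial>M) \<le> (\<integral>\<xi>. lip_reg \<Xi> (\<theta> \<nu>) q \<xi> (xs \<nu>) \<partial>M)"
    proof (rule integral_mono)
      show "integrable M (m \<nu>)"
        using m_bound by (intro integrable_const_bound[of _ B]) (auto simp: sp)
      show "m \<nu> \<xi> \<le> lip_reg \<Xi> (\<theta> \<nu>) q \<xi> (xs \<nu>)" if "\<xi> \<in> space M" for \<xi>
      proof -
        have "\<bar>lip_reg \<Xi> (\<theta> \<nu>) q \<xi> (xs \<nu>)\<bar> \<le> B"
          using that elim(1) by (intro abs_lip_reg_le \<theta>(1)) (auto simp: sp)
        then show ?thesis by (simp add: m_def)
      qed
    qed (rule lip_reg_integrable[OF M bdd \<theta>(1)])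
    with elim(2) show ?case by linarith
  qed
qed

text \<open>Once \<open>\<theta> \<nu> < 1\<close>, the number
  \<open>(1 + \<bar>B\<bar>) / \<theta> \<nu>\<close> dominates both the modulus
  \<open>1 / \<theta> \<nu>\<close> and the bound \<open>B\<close>. The factor
  \<open>1 + \<bar>B\<bar>\<close> is the same for all \<open>\<nu>\<close>, which makes the error
  proportional to the scaled distance.\<close>

lemma integral_lip_reg_diff:
  fixes \<Xi> :: "'a::real_normed_vector set" and q :: "'a \<Rightarrow> 'b::real_normed_vector \<Rightarrow> real"
  assumes M: "M \<in> prob_measures \<Xi>" and Ms: "\<And>\<nu>. Ms \<nu> \<in> prob_measures \<Xi>"
    and bdd: "locally_unif_bounded \<Xi> q"
    and \<theta>: "\<And>\<nu>. \<theta> \<nu> > 0" "\<theta> \<longlonglongrightarrow> 0" and x: "xs \<longlonglongrightarrow> x"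
  obtains C where "C \<ge> 0"
    "eventually (\<lambda>\<nu>. \<bar>(\<integral>\<xi>. lip_reg \<Xi> (\<theta> \<nu>) q \<xi> (xs \<nu>) \<partial>Ms \<nu>)
        - (\<integral>\<xi>. lip_reg \<Xi> (\<theta> \<nu>) q \<xi> (xs \<nu>) \<partial>M)\<bar>
      \<le> C * (1 / \<theta> \<nu> * d_BL \<Xi> (Ms \<nu>) M)) sequentially"
proof -
  obtain B where evB: "eventually (\<lambda>\<nu>. \<forall>\<zeta>\<in>\<Xi>. \<bar>q \<zeta> (xs \<nu>)\<bar> \<le> B) sequentially"
    using locally_unif_boundedE[OF bdd x] by blast
  define C where "C = 1 + \<bar>B\<bar>"
  have "eventually (\<lambda>\<nu>. \<theta> \<nu> < 1) sequentially"
    using order_tendstoD(2)[OF \<theta>(2)] by simp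
  with evB have "eventually (\<lambda>\<nu>. \<bar>(\<integral>\<xi>. lip_reg \<Xi> (\<theta> \<nu>) q \<xi> (xs \<nu>) \<partial>Ms \<nu>)
        - (\<integral>\<xi>. lip_reg \<Xi> (\<theta> \<nu>) q \<xi> (xs \<nu>) \<partial>M)\<bar>
      \<le> C * (1 / \<theta> \<nu> * d_BL \<Xi> (Ms \<nu>) M)) sequentially"
  proof eventually_elim
    case (elim \<nu>)
    have low: "- B \<le> q \<zeta> (xs \<nu>)" if "\<zeta> \<in> \<Xi>" for \<zeta>
      using elim(1) that by fastforce
    have "C * \<theta> \<nu> \<le> C"
      using \<theta>(1)[of \<nu>] elim(2) by (intro mult_left_le) (auto simp: C_def)
    then have K: "1 / \<theta> \<nu> \<le> C / \<theta> \<nu>" "C \<le> C / \<theta> \<nu>"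
      using \<theta>(1)[of \<nu>] by (auto simp: C_def divide_right_mono pos_le_divide_eq)
    have "\<bar>(\<integral>\<xi>. lip_reg \<Xi> (\<theta> \<nu>) q \<xi> (xs \<nu>) \<partial>Ms \<nu>)
        - (\<integral>\<xi>. lip_reg \<Xi> (\<theta> \<nu>) q \<xi> (xs \<nu>) \<partial>M)\<bar> \<le> (C / \<theta> \<nu>) * d_BL \<Xi> (Ms \<nu>) M"
    proof (rule abs_integral_diff_le_d_BL[OF Ms M])
      show "(C / \<theta> \<nu>)-lipschitz_on \<Xi> (\<lambda>\<xi>. lip_reg \<Xi> (\<theta> \<nu>) q \<xi> (xs \<nu>))"
        by (rule lipschitz_on_mono[OF lipschitz_on_lip_reg[of \<Xi> "- B" q "xs \<nu>"] order_refl K(1)])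
           (use low \<theta>(1) in auto)
      show "\<bar>lip_reg \<Xi> (\<theta> \<nu>) q \<xi> (xs \<nu>)\<bar> \<le> C / \<theta> \<nu>" if "\<xi> \<in> \<Xi>" for \<xi>
      proof -
        have "\<bar>lip_reg \<Xi> (\<theta> \<nu>) q \<xi> (xs \<nu>)\<bar> \<le> B"
          using that elim(1) by (intro abs_lip_reg_le \<theta>(1)) auto
        with K(2) show ?thesis unfolding C_def by linarith
      qed
      show "C / \<theta> \<nu> > 0"
        using \<theta>(1)[of \<nu>] by (simp add: C_def)
    qed
    then show ?case by simp
  qed
  moreover have "C \<ge> 0" by (simp add: C_def)
  ultimately show thesis
    using that by blast
qed

text \<open>Passing through the integral under \<open>M\<close> confines the limit argument to a
  single measure; the room between \<open>c\<close> and \<open>c'\<close> absorbs the change of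
  measure.\<close>

lemma integral_lip_reg_varying_lower_limit:
  fixes \<Xi> :: "'a::real_normed_vector set" and q :: "'a \<Rightarrow> 'b::real_normed_vector \<Rightarrow> real"
  assumes M: "M \<in> prob_measures \<Xi>" and Ms: "\<And>\<nu>. Ms \<nu> \<in> prob_measures \<Xi>"
    and lsc: "lsc_on (\<Xi> \<times> UNIV) (\<lambda>(\<xi>, x). q \<xi> x)" and bdd: "locally_unif_bounded \<Xi> q"
    and \<theta>: "\<And>\<nu>. \<theta> \<nu> > 0" "\<theta> \<longlonglongrightarrow> 0"
    and d: "(\<lambda>\<nu>. 1 / \<theta> \<nu> * d_BL \<Xi> (Ms \<nu>) M) \<longlonglongrightarrow> 0"
    and x: "xs \<longlonglongrightarrow> x" and c: "c < (\<integral>\<xi>. q \<xi> x \<partial>M)"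
  shows "eventually (\<lambda>\<nu>. c < (\<integral>\<xi>. lip_reg \<Xi> (\<theta> \<nu>) q \<xi> (xs \<nu>) \<partial>Ms \<nu>)) sequentially"
proof -
  obtain c' where c': "c < c'" "c' < (\<integral>\<xi>. q \<xi> x \<partial>M)"
    using c dense by blast
  obtain C where "eventually (\<lambda>\<nu>. \<bar>(\<integral>\<xi>. lip_reg \<Xi> (\<theta> \<nu>) q \<xi> (xs \<nu>) \<partial>Ms \<nu>)
        - (\<integral>\<xi>. lip_reg \<Xi> (\<theta> \<nu>) q \<xi> (xs \<nu>) \<partial>M)\<bar>
      \<le> C * (1 / \<theta> \<nu> * d_BL \<Xi> (Ms \<nu>) M)) sequentially"
    by (rule integral_lip_reg_diff[where q = q, OF M Ms bdd \<theta> x], rule that)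
  moreover have "eventually (\<lambda>\<nu>. C * (1 / \<theta> \<nu> * d_BL \<Xi> (Ms \<nu>) M) < c' - c) sequentially"
    using c'(1) by (intro order_tendstoD(2)[OF tendsto_mult_right_zero[OF d]]) simp
  moreover note integral_lip_reg_lower_limit[OF M lsc bdd \<theta> x c'(2)]
  ultimately show ?thesis
  proof eventually_elim
    case (elim \<nu>)
    then show ?case by linarith
  qed
qed

lemma integral_vec_lambda:
  fixes f :: "'i::finite \<Rightarrow> 'a \<Rightarrow> real"
  assumes "\<And>i. integrable M (f i)"
  shows "(\<integral>\<xi>. (\<chi> i. f i \<xi>) \<partial>M) = (\<chi> i. \<integral>\<xi>. f i \<xi> \<partial>M)"
proof -
  \<comment> \<open>Expansion in the coordinate basis reduces the claim to linearity of the
    integral.\<close>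
  have *: "(\<chi> i. a i) = (\<Sum>i\<in>UNIV. a i *\<^sub>R axis i 1)" for a :: "'i \<Rightarrow> real"
    by (simp add: vec_eq_iff axis_def if_distrib cong: if_cong)
  show ?thesis
    unfolding * using assms by (simp add: integral_sum)
qed

section \<open>Epi-convergence of the relaxed problems\<close>

lemma lsc_on_UNIV_eventually:
  assumes "lsc_on UNIV \<psi>" "w \<longlonglongrightarrow> z" "c < \<psi> z"
  shows "eventually (\<lambda>\<nu>. c < \<psi> (w \<nu>)) sequentially"
proof -
  have "eventually (\<lambda>y. c < \<psi> y) (nhds z)"
    using assms(1,3) by (auto simp: lsc_on_def eventually_nhds_conv_at)
  then show ?thesis
    using assms(2) by (rule eventually_compose_filterlim)
qed

text \<open>\<open>vs\<close> need not converge, but its componentwise minimum with \<open>v\<close>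
  does, and \<open>h\<close> is no larger there.\<close>

lemma nondecreasing_lsc_eventually:
  fixes h :: "real ^ 'm \<Rightarrow> ereal"
  assumes lsc: "lsc_on UNIV h" and mono: "\<And>y z. (\<forall>i. y $ i \<ge> z $ i) \<Longrightarrow> h y \<ge> h z"
    and v: "\<And>i c. c < v $ i \<Longrightarrow> eventually (\<lambda>\<nu>. c < vs \<nu> $ i) sequentially" and c: "c < h v"
  shows "eventually (\<lambda>\<nu>. c < h (vs \<nu>)) sequentially"
proof -
  define w where "w \<nu> = (\<chi> i. min (vs \<nu> $ i) (v $ i))" for \<nu>
  have "w \<longlonglongrightarrow> v"
  proof (rule vec_tendstoI)
    fix i show "(\<lambda>\<nu>. w \<nu> $ i) \<longlonglongrightarrow> v $ i"
    proof (rule order_tendstoI)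
      fix a assume "a < v $ i"
      with v[of a i] show "eventually (\<lambda>\<nu>. a < w \<nu> $ i) sequentially"
        by (simp add: w_def)
    next
      fix a assume "v $ i < a"
      then show "eventually (\<lambda>\<nu>. w \<nu> $ i < a) sequentially"
        by (simp add: w_def min_less_iff_disj)
    qed
  qed
  from lsc_on_UNIV_eventually[OF lsc this c] show ?thesis
  proof eventually_elim
    case (elim \<nu>)
    have "h (w \<nu>) \<le> h (vs \<nu>)"
      by (rule mono) (simp add: w_def)
    with elim show ?case by simp
  qed
qed

text \<open>At \<open>u = 0\<close> nonnegativity of the penalty suffices; elsewhere its factor
  tends to \<infinity> while the power of the norm stays away from 0.\<close>

lemma penalty_liminf:
  assumes \<alpha>: "\<alpha> \<ge> 1" and lam: "\<And>\<nu>. lam \<nu> > 0" "lam \<longlonglongrightarrow> 0" and u: "us \<longlonglongrightarrow> u"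
  shows "iota {0} u \<le> liminf (\<lambda>\<nu>. ereal (1 / (\<alpha> * lam \<nu>) * norm (us \<nu>) powr \<alpha>))"
proof (cases "u = 0")
  case True
  have "0 \<le> 1 / (\<alpha> * lam \<nu>) * norm (us \<nu>) powr \<alpha>" for \<nu>
    using \<alpha> lam(1)[of \<nu>] by simp
  with True show ?thesis
    by (simp add: iota_def Liminf_bounded)
next
  case False
  have "filterlim (\<lambda>\<nu>. inverse (\<alpha> * lam \<nu>)) at_top sequentially"
  proof (rule filterlim_inverse_at_top)
    show "(\<lambda>\<nu>. \<alpha> * lam \<nu>) \<longlonglongrightarrow> 0"
      by (rule tendsto_mult_right_zero[OF lam(2)])
    show "eventually (\<lambda>\<nu>. 0 < \<alpha> * lam \<nu>) sequentially"
      using \<alpha> lam(1) by (intro always_eventually allI mult_pos_pos) auto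
  qed
  moreover have "(\<lambda>\<nu>. norm (us \<nu>) powr \<alpha>) \<longlonglongrightarrow> norm u powr \<alpha>"
    using False by (intro tendsto_powr tendsto_norm u tendsto_const) auto
  moreover have "0 < norm u powr \<alpha>"
    using False by simp
  ultimately have "filterlim (\<lambda>\<nu>. inverse (\<alpha> * lam \<nu>) * norm (us \<nu>) powr \<alpha>) at_top sequentially"
    by (intro filterlim_at_top_mult_tendsto_pos)
  then have "(\<lambda>\<nu>. ereal (1 / (\<alpha> * lam \<nu>) * norm (us \<nu>) powr \<alpha>)) \<longlonglongrightarrow> \<infinity>"
    by (simp add: tendsto_PInfty_eq_at_top inverse_eq_divide)
  then show ?thesis
    by (simp add: lim_imp_Liminf)
qed

text \<open>The argument with the integrals abstracted away: \<open>A\<close> stands for the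
  limiting expectation, \<open>a \<nu>\<close> and \<open>b \<nu>\<close> for the regularized
  expectation under the approximating and the limiting measure, and \<open>t \<nu>\<close> for the
  scaled distance. The intermediate \<open>b\<close> splits the error: regularization has a
  favourable sign, the change of measure has a size.\<close>

lemma relaxed_epi_converges:
  fixes g0 :: "'n::metric_space \<Rightarrow> ereal" and h :: "real ^ 'm \<Rightarrow> ereal"
    and A :: "'n \<Rightarrow> real ^ 'm" and a b :: "nat \<Rightarrow> 'n \<Rightarrow> real ^ 'm"
  assumes g0: "proper g0" "lsc_on UNIV g0"
    and h: "proper h" "lsc_on UNIV h" "\<And>y z. (\<forall>i. y $ i \<ge> z $ i) \<Longrightarrow> h y \<ge> h z"
    and \<alpha>: "\<alpha> \<ge> 1" and lam: "\<And>\<nu>. lam \<nu> > 0" "lam \<longlonglongrightarrow> 0"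
    and t: "\<And>\<nu>. t \<nu> \<ge> 0" "t \<longlonglongrightarrow> 0" "(\<lambda>\<nu>. 1 / lam \<nu> * t \<nu> powr \<alpha>) \<longlonglongrightarrow> 0"
    and lower: "\<And>xs x c i. xs \<longlonglongrightarrow> x \<Longrightarrow> c < A x $ i \<Longrightarrow>
        eventually (\<lambda>\<nu>. c < a \<nu> (xs \<nu>) $ i) sequentially"
    and b_le: "\<And>\<nu> x i. b \<nu> x $ i \<le> A x $ i"
    and b_a: "\<And>x. \<exists>C\<ge>0. eventually (\<lambda>\<nu>. norm (b \<nu> x - a \<nu> x) \<le> C * t \<nu>) sequentially"
    and f: "\<And>u x. f (u, x) = g0 x + h (u + A x) + iota {0} u"
    and fs: "\<And>\<nu> u x. fs \<nu> (u, x) = g0 x + h (u + a \<nu> x) + ereal (1 / (\<alpha> * lam \<nu>) * norm u powr \<alpha>)"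
  shows "epi_converges fs f"
  unfolding epi_converges_def
proof (intro allI conjI impI)
  fix z :: "(real ^ 'm) \<times> 'n" and w assume w: "w \<longlonglongrightarrow> z"
  define u x us xs where "u = fst z" and "x = snd z" and "us = (\<lambda>\<nu>. fst (w \<nu>))" and "xs = (\<lambda>\<nu>. snd (w \<nu>))"
  have lims: "us \<longlonglongrightarrow> u" "xs \<longlonglongrightarrow> x"
    unfolding us_def u_def xs_def x_def using w by (auto intro: tendsto_fst tendsto_snd)
  define P where "P \<nu> = ereal (1 / (\<alpha> * lam \<nu>) * norm (us \<nu>) powr \<alpha>)" for \<nu>
  have 1: "g0 x \<le> liminf (\<lambda>\<nu>. g0 (xs \<nu>))"
    unfolding le_Liminf_iff using lsc_on_UNIV_eventually[OF g0(2) lims(2)] by blast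
  have "h (u + A x) \<le> liminf (\<lambda>\<nu>. h (us \<nu> + a \<nu> (xs \<nu>)))"
    unfolding le_Liminf_iff
  proof (intro allI impI nondecreasing_lsc_eventually[OF h(2,3)])
    fix i c assume c: "c < (u + A x) $ i"
    define d where "d = ((u + A x) $ i - c) / 2"
    have d: "d > 0" using c by (simp add: d_def)
    have "(\<lambda>\<nu>. us \<nu> $ i) \<longlonglongrightarrow> u $ i"
      by (rule tendsto_vec_nth[OF lims(1)])
    then have "eventually (\<lambda>\<nu>. u $ i - d < us \<nu> $ i) sequentially"
      using d by (intro order_tendstoD(1)) auto
    moreover have "eventually (\<lambda>\<nu>. A x $ i - d < a \<nu> (xs \<nu>) $ i) sequentially"
      using d by (intro lower[OF lims(2)]) simp
    ultimately show "eventually (\<lambda>\<nu>. c < (us \<nu> + a \<nu> (xs \<nu>)) $ i) sequentially"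
    proof eventually_elim
      case (elim \<nu>)
      then show ?case by (simp add: d_def field_simps)
    qed
  qed auto
  note 2 = this
  have 3: "iota {0} u \<le> liminf P"
    unfolding P_def by (rule penalty_liminf[OF \<alpha> lam lims(1)])
  \<comment> \<open>Superadditivity of the lower limit fails for opposite infinities; properness at
    the limit point rules them out through the bounds 1, 2 and 3.\<close>
  have ne: "g0 x \<noteq> -\<infinity>" "h (u + A x) \<noteq> -\<infinity>" "iota {0} u \<noteq> -\<infinity>"
    using g0(1) h(1) by (auto simp: proper_def iota_def)
  have "g0 x + h (u + A x) + iota {0} u
    \<le> liminf (\<lambda>\<nu>. g0 (xs \<nu>)) + liminf (\<lambda>\<nu>. h (us \<nu> + a \<nu> (xs \<nu>))) + liminf P"
    using 1 2 3 by (intro add_mono)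
  also have "\<dots> \<le> liminf (\<lambda>\<nu>. g0 (xs \<nu>) + h (us \<nu> + a \<nu> (xs \<nu>))) + liminf P"
    using 1 2 ne by (intro add_right_mono ereal_liminf_add_mono) auto
  also have "\<dots> \<le> liminf (\<lambda>\<nu>. g0 (xs \<nu>) + h (us \<nu> + a \<nu> (xs \<nu>)) + P \<nu>)"
  proof (rule ereal_liminf_add_mono)
    have "g0 x + h (u + A x) \<le> liminf (\<lambda>\<nu>. g0 (xs \<nu>)) + liminf (\<lambda>\<nu>. h (us \<nu> + a \<nu> (xs \<nu>)))"
      using 1 2 by (intro add_mono)
    also have "\<dots> \<le> liminf (\<lambda>\<nu>. g0 (xs \<nu>) + h (us \<nu> + a \<nu> (xs \<nu>)))"
      using 1 2 ne by (intro ereal_liminf_add_mono) auto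
    finally have "liminf (\<lambda>\<nu>. g0 (xs \<nu>) + h (us \<nu> + a \<nu> (xs \<nu>))) \<noteq> -\<infinity>"
      using ne by auto
    moreover have "liminf P \<noteq> -\<infinity>"
      using 3 ne by auto
    ultimately show "\<not> (liminf (\<lambda>\<nu>. g0 (xs \<nu>) + h (us \<nu> + a \<nu> (xs \<nu>))) = \<infinity> \<and> liminf P = -\<infinity>
        \<or> liminf (\<lambda>\<nu>. g0 (xs \<nu>) + h (us \<nu> + a \<nu> (xs \<nu>))) = -\<infinity> \<and> liminf P = \<infinity>)"
      by blast
  qed
  also have "(\<lambda>\<nu>. g0 (xs \<nu>) + h (us \<nu> + a \<nu> (xs \<nu>)) + P \<nu>) = (\<lambda>\<nu>. fs \<nu> (w \<nu>))"
    using fs[of \<nu> "fst (w \<nu>)" "snd (w \<nu>)" for \<nu>] by (simp add: P_def us_def xs_def)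
  finally show "f z \<le> liminf (\<lambda>\<nu>. fs \<nu> (w \<nu>))"
    using f[of "fst z" "snd z"] by (simp add: u_def x_def)
next
  fix z :: "(real ^ 'm) \<times> 'n"
  obtain u x where z: "z = (u, x)" by force
  show "\<exists>w. w \<longlonglongrightarrow> z \<and> limsup (\<lambda>\<nu>. fs \<nu> (w \<nu>)) \<le> f z"
  proof (cases "u = 0")
    case False
    have "f z = \<infinity>"
      using False g0(1) h(1) by (auto simp: z f iota_def proper_def)
    then show ?thesis
      by (intro exI[of _ "\<lambda>_. z"]) simp
  next
    case True
    obtain C where C: "C \<ge> 0" "eventually (\<lambda>\<nu>. norm (b \<nu> x - a \<nu> x) \<le> C * t \<nu>) sequentially"
      using b_a by blast
    \<comment> \<open>The perturbation trades the expectation under the approximating measure for the one under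
      the limiting measure, which regularization can only decrease.\<close>
    define us where "us \<nu> = b \<nu> x - a \<nu> x" for \<nu>
    have "us \<longlonglongrightarrow> 0"
      using C(2) unfolding us_def by (rule Lim_null_comparison) (rule tendsto_mult_right_zero[OF t(2)])
    define p where "p \<nu> = 1 / (\<alpha> * lam \<nu>) * norm (us \<nu>) powr \<alpha>" for \<nu>
    have "p \<longlonglongrightarrow> 0"
    proof (rule Lim_null_comparison)
      \<comment> \<open>The constant remains after \<open>C\<close> is pulled out of the power; the
        other factor is the rate condition.\<close>
      show "(\<lambda>\<nu>. C powr \<alpha> / \<alpha> * (1 / lam \<nu> * t \<nu> powr \<alpha>)) \<longlonglongrightarrow> 0"
        by (rule tendsto_mult_right_zero[OF t(3)])
      show "eventually (\<lambda>\<nu>. norm (p \<nu>) \<le> C powr \<alpha> / \<alpha> * (1 / lam \<nu> * t \<nu> powr \<alpha>)) sequentially"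
        using C(2)
      proof eventually_elim
        case (elim \<nu>)
        have "norm (us \<nu>) powr \<alpha> \<le> (C * t \<nu>) powr \<alpha>"
          using elim \<alpha> by (intro powr_mono2) (auto simp: us_def)
        also have "\<dots> = C powr \<alpha> * t \<nu> powr \<alpha>"
          using C(1) t(1) by (simp add: powr_mult)
        finally have "p \<nu> \<le> 1 / (\<alpha> * lam \<nu>) * (C powr \<alpha> * t \<nu> powr \<alpha>)"
          unfolding p_def using \<alpha> lam(1)[of \<nu>] by (intro mult_left_mono) auto
        moreover have "0 \<le> p \<nu>"
          using \<alpha> lam(1)[of \<nu>] by (simp add: p_def)
        ultimately show ?case by simp
      qed
    qed
    have "fs \<nu> (us \<nu>, x) \<le> g0 x + h (A x) + ereal (p \<nu>)" for \<nu>
    proof -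
      have "h (us \<nu> + a \<nu> x) \<le> h (A x)"
        using b_le by (intro h(3)) (simp add: us_def)
      then show ?thesis
        unfolding fs p_def by (intro add_mono) auto
    qed
    then have "limsup (\<lambda>\<nu>. fs \<nu> (us \<nu>, x)) \<le> limsup (\<lambda>\<nu>. g0 x + h (A x) + ereal (p \<nu>))"
      by (intro Limsup_mono always_eventually) auto
    also have "\<dots> \<le> limsup (\<lambda>\<nu>. g0 x + h (A x)) + limsup (\<lambda>\<nu>. ereal (p \<nu>))"
      by (rule ereal_limsup_add_mono)
    also have "limsup (\<lambda>\<nu>. ereal (p \<nu>)) = 0"
      using \<open>p \<longlonglongrightarrow> 0\<close> by (intro lim_imp_Limsup) (auto simp: zero_ereal_def)
    finally have "limsup (\<lambda>\<nu>. fs \<nu> (us \<nu>, x)) \<le> f z"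
      using True by (simp add: z f iota_def Limsup_const)
    moreover have "(\<lambda>\<nu>. (us \<nu>, x)) \<longlonglongrightarrow> z"
      unfolding z True by (intro tendsto_Pair tendsto_const \<open>us \<longlonglongrightarrow> 0\<close>)
    ultimately show ?thesis by blast
  qed
qed

section \<open>Reduction of the constrained problem to one slice\<close>

lemma INF_constrained_eq:
  fixes f :: "'a \<times> 'b \<Rightarrow> ereal"
  assumes "\<And>x. f (u0, x) = \<phi> x" "\<And>u x. u \<noteq> u0 \<Longrightarrow> f (u, x) = \<infinity>"
  shows "(INF z. f z) = (INF x. \<phi> x)"
proof (rule antisym)
  show "(INF z. f z) \<le> (INF x. \<phi> x)"
    by (rule INF_greatest) (metis INF_lower UNIV_I assms(1))
  show "(INF x. \<phi> x) \<le> (INF z. f z)"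
  proof (rule INF_greatest)
    fix z :: "'a \<times> 'b"
    show "(INF x. \<phi> x) \<le> f z"
      using assms by (cases z; cases "fst z = u0") (auto intro: INF_lower)
  qed
qed

lemma eps_argmin_constrained_eq:
  fixes f :: "'a \<times> 'b \<Rightarrow> ereal"
  assumes "\<And>x. f (u0, x) = \<phi> x" "\<And>u x. u \<noteq> u0 \<Longrightarrow> f (u, x) = \<infinity>"
  shows "eps_argmin \<epsilon> f = {u0} \<times> eps_argmin \<epsilon> \<phi>"
proof (rule set_eqI)
  fix z :: "'a \<times> 'b"
  show "z \<in> eps_argmin \<epsilon> f \<longleftrightarrow> z \<in> {u0} \<times> eps_argmin \<epsilon> \<phi>"
    using assms INF_constrained_eq[of f u0 \<phi>, OF assms]
    by (cases z; cases "fst z = u0") (auto simp: eps_argmin_def domain_def)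
qed

theorem proposition3p8:
  fixes \<Xi> :: "(real ^ 'd) set"
    and g0 :: "real ^ 'n \<Rightarrow> ereal"
    and h :: "real ^ 'm \<Rightarrow> ereal"
    and g :: "'m \<Rightarrow> real ^ 'd \<Rightarrow> real ^ 'n \<Rightarrow> real"
    and G :: "real ^ 'd \<Rightarrow> real ^ 'n \<Rightarrow> real ^ 'm"
    and G\<nu> :: "nat \<Rightarrow> real ^ 'd \<Rightarrow> real ^ 'n \<Rightarrow> real ^ 'm"
    and \<mu> :: "(real ^ 'd) measure"
    and \<mu>\<nu> :: "nat \<Rightarrow> (real ^ 'd) measure"
    and \<alpha> :: real
    and lam \<theta> :: "nat \<Rightarrow> real"
    and \<phi> :: "real ^ 'n \<Rightarrow> ereal"
    and f :: "(real ^ 'm) \<times> (real ^ 'n) \<Rightarrow> ereal"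
    and f\<nu> :: "nat \<Rightarrow> (real ^ 'm) \<times> (real ^ 'n) \<Rightarrow> ereal"
  assumes \<Xi>: "\<Xi> \<noteq> {}" "closed \<Xi>"
    and g0: "proper g0" "lsc_on UNIV g0"
    and h: "proper h" "lsc_on UNIV h" "\<And>y z. (\<forall>i. y $ i \<ge> z $ i) \<Longrightarrow> h y \<ge> h z"
    and g_lsc: "\<And>i. lsc_on (\<Xi> \<times> UNIV) (\<lambda>(\<xi>, x). g i \<xi> x)"
    and g_bdd: "\<And>i. locally_unif_bounded \<Xi> (g i)"
    and G: "\<And>\<xi> x. G \<xi> x = (\<chi> i. g i \<xi> x)"
    and G\<nu>: "\<And>\<nu> \<xi> x. G\<nu> \<nu> \<xi> x = (\<chi> i. lip_reg \<Xi> (\<theta> \<nu>) (g i) \<xi> x)"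
    and \<mu>: "\<mu> \<in> prob_measures \<Xi>"
    and \<mu>\<nu>: "\<And>\<nu>. \<mu>\<nu> \<nu> \<in> prob_measures \<Xi>"
    and \<mu>\<nu>_conv: "(\<lambda>\<nu>. d_BL \<Xi> (\<mu>\<nu> \<nu>) \<mu>) \<longlonglongrightarrow> 0"
    and \<alpha>: "\<alpha> \<ge> 1"
    and lam: "\<And>\<nu>. lam \<nu> > 0" "lam \<longlonglongrightarrow> 0"
    and \<theta>: "\<And>\<nu>. \<theta> \<nu> > 0" "\<theta> \<longlonglongrightarrow> 0"
    and rate: "(\<lambda>\<nu>. 1 / lam \<nu> * (1 / \<theta> \<nu> * d_BL \<Xi> (\<mu>\<nu> \<nu>) \<mu>) powr \<alpha>) \<longlonglongrightarrow> 0"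
    and \<phi>: "\<And>x. \<phi> x = g0 x + h (\<integral>\<xi>. G \<xi> x \<partial>\<mu>)"
    and f: "\<And>u x. f (u, x) = g0 x + h (u + (\<integral>\<xi>. G \<xi> x \<partial>\<mu>)) + iota {0} u"
    and f\<nu>: "\<And>\<nu> u x. f\<nu> \<nu> (u, x) = g0 x + h (u + (\<integral>\<xi>. G\<nu> \<nu> \<xi> x \<partial>\<mu>\<nu> \<nu>))
                                    + ereal (1 / (\<alpha> * lam \<nu>) * norm u powr \<alpha>)"
    and argmin_\<phi>: "argmin \<phi> \<noteq> {}"
  shows "epi_converges f\<nu> f
    \<comment> \<open>(a)\<close>
    \<and> ((INF z. f z) = (INF x. \<phi> x)
        \<and> (\<forall>\<epsilon>\<ge>0. eps_argmin \<epsilon> f = {0} \<times> eps_argmin \<epsilon> \<phi>))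
    \<comment> \<open>(b)\<close>
    \<and> limsup (\<lambda>\<nu>. INF z. f\<nu> \<nu> z) \<le> (INF z. f z)
    \<comment> \<open>(c)\<close>
    \<and> (\<forall>\<epsilon>\<nu> \<epsilon>. (\<forall>\<nu>. \<epsilon>\<nu> \<nu> \<ge> 0) \<and> \<epsilon> \<ge> 0 \<and> \<epsilon>\<nu> \<longlonglongrightarrow> \<epsilon>
          \<longrightarrow> LimOut (\<lambda>\<nu>. eps_argmin (\<epsilon>\<nu> \<nu>) (f\<nu> \<nu>)) \<subseteq> eps_argmin \<epsilon> f)
    \<comment> \<open>(d)\<close>
    \<and> (\<forall>\<epsilon>\<nu> N z l. (\<forall>\<nu>. \<epsilon>\<nu> \<nu> \<ge> 0) \<and> \<epsilon>\<nu> \<longlonglongrightarrow> 0 \<and> infinite N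
          \<and> (\<forall>\<nu>\<in>N. z \<nu> \<in> eps_argmin (\<epsilon>\<nu> \<nu>) (f\<nu> \<nu>)) \<and> (z \<longlongrightarrow> l) (along N)
          \<longrightarrow> ((\<lambda>\<nu>. INF z. f\<nu> \<nu> z) \<longlongrightarrow> (INF z. f z)) (along N))
    \<comment> \<open>(e)\<close>
    \<and> ((\<lambda>\<nu>. INF z. f\<nu> \<nu> z) \<longlonglongrightarrow> (INF z. f z) \<longleftrightarrow> tight_functions f\<nu>)
    \<comment> \<open>(f)\<close>
    \<and> ((\<lambda>\<nu>. INF z. f\<nu> \<nu> z) \<longlonglongrightarrow> (INF z. f z) \<longrightarrow>
        (\<forall>x0\<in>argmin \<phi>. \<exists>\<epsilon>\<nu>. (\<forall>\<nu>. \<epsilon>\<nu> \<nu> \<ge> 0) \<and> \<epsilon>\<nu> \<longlonglongrightarrow> 0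
            \<and> (0, x0) \<in> LimInn (\<lambda>\<nu>. eps_argmin (\<epsilon>\<nu> \<nu>) (f\<nu> \<nu>))))
    \<comment> \<open>(g)\<close>
    \<and> ((\<lambda>\<nu>. INF z. f\<nu> \<nu> z) \<longlonglongrightarrow> (INF z. f z) \<longrightarrow>
        (\<exists>\<epsilon>\<nu>. (\<forall>\<nu>. \<epsilon>\<nu> \<nu> \<ge> 0) \<and> \<epsilon>\<nu> \<longlonglongrightarrow> 0
            \<and> set_Lim (\<lambda>\<nu>. eps_argmin (\<epsilon>\<nu> \<nu>) (f\<nu> \<nu>)) (argmin f)))"
proof -
  define t where "t \<nu> = 1 / \<theta> \<nu> * d_BL \<Xi> (\<mu>\<nu> \<nu>) \<mu>" for \<nu>
  have t_nonneg: "t \<nu> \<ge> 0" for \<nu>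
    using \<theta>(1)[of \<nu>] d_BL_nonneg[OF \<mu>\<nu> \<mu>] by (simp add: t_def)
  have t_rate: "(\<lambda>\<nu>. 1 / lam \<nu> * t \<nu> powr \<alpha>) \<longlonglongrightarrow> 0"
    using rate by (simp only: t_def)
  \<comment> \<open>Convergence of the distance alone says nothing after division by
    \<open>\<theta> \<nu>\<close>. Multiplying the rate by the vanishing \<open>lam\<close> gives
    \<open>t powr \<alpha>\<close> tending to 0, and the root \<open>1 / \<alpha>\<close> recovers
    \<open>t\<close>.\<close>
  have "(\<lambda>\<nu>. lam \<nu> * (1 / lam \<nu> * t \<nu> powr \<alpha>)) \<longlonglongrightarrow> 0"
    using tendsto_mult[OF lam(2) t_rate] by simp
  also have "(\<lambda>\<nu>. lam \<nu> * (1 / lam \<nu> * t \<nu> powr \<alpha>)) = (\<lambda>\<nu>. t \<nu> powr \<alpha>)"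
    using lam(1) by (simp add: less_imp_neq[symmetric])
  finally have "(\<lambda>\<nu>. t \<nu> powr \<alpha>) \<longlonglongrightarrow> 0" .
  from tendsto_zero_powrI[OF this tendsto_const, of "1 / \<alpha>"]
  have "(\<lambda>\<nu>. (t \<nu> powr \<alpha>) powr (1 / \<alpha>)) \<longlonglongrightarrow> 0"
    using \<alpha> by simp
  moreover have "(t \<nu> powr \<alpha>) powr (1 / \<alpha>) = t \<nu>" for \<nu>
    using \<alpha> t_nonneg[of \<nu>] by (simp add: powr_powr)
  ultimately have t_lim: "t \<longlonglongrightarrow> 0"
    by simp

  have EG: "(\<integral>\<xi>. G \<xi> x \<partial>\<mu>) = (\<chi> i. \<integral>\<xi>. g i \<xi> x \<partial>\<mu>)" for x
    unfolding G by (intro integral_vec_lambda lsc_bounded_integrable[OF \<mu> g_lsc g_bdd])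
  \<comment> \<open>The measure is left general because the regularized expectation is needed under
    \<open>\<mu>\<nu> \<nu>\<close> and, for the recovery shift, under \<open>\<mu>\<close>.\<close>
  have EG\<nu>: "(\<integral>\<xi>. G\<nu> \<nu> \<xi> x \<partial>M) = (\<chi> i. \<integral>\<xi>. lip_reg \<Xi> (\<theta> \<nu>) (g i) \<xi> x \<partial>M)"
    if "M \<in> prob_measures \<Xi>" for \<nu> x M
    unfolding G\<nu> by (intro integral_vec_lambda lip_reg_integrable[OF that g_bdd \<theta>(1)])

  have epi: "epi_converges f\<nu> f"
  proof (rule relaxed_epi_converges[OF g0 h \<alpha> lam t_nonneg t_lim t_rate _ _ _ f f\<nu>])
    show "eventually (\<lambda>\<nu>. c < (\<integral>\<xi>. G\<nu> \<nu> \<xi> (xs \<nu>) \<partial>\<mu>\<nu> \<nu>) $ i) sequentially"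
      if "xs \<longlonglongrightarrow> x" "c < (\<integral>\<xi>. G \<xi> x \<partial>\<mu>) $ i" for xs x c i
      using integral_lip_reg_varying_lower_limit[OF \<mu> \<mu>\<nu> g_lsc g_bdd \<theta> t_lim[unfolded t_def] that(1), of c i] that(2)
      by (simp add: EG EG\<nu>[OF \<mu>\<nu>])
    show "(\<integral>\<xi>. G\<nu> \<nu> \<xi> x \<partial>\<mu>) $ i \<le> (\<integral>\<xi>. G \<xi> x \<partial>\<mu>) $ i" for \<nu> x i
      using integral_lip_reg_le[OF \<mu> g_lsc g_bdd \<theta>(1)] by (simp add: EG EG\<nu>[OF \<mu>])
    show "\<exists>C\<ge>0. eventually (\<lambda>\<nu>. norm ((\<integral>\<xi>. G\<nu> \<nu> \<xi> x \<partial>\<mu>) - (\<integral>\<xi>. G\<nu> \<nu> \<xi> x \<partial>\<mu>\<nu> \<nu>)) \<le> C * t \<nu>) sequentially" for x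
    proof -
      let ?I = "\<lambda>M \<nu> i. \<integral>\<xi>. lip_reg \<Xi> (\<theta> \<nu>) (g i) \<xi> x \<partial>M"
      have "\<exists>C. C \<ge> 0 \<and> eventually (\<lambda>\<nu>. \<bar>?I (\<mu>\<nu> \<nu>) \<nu> i - ?I \<mu> \<nu> i\<bar> \<le> C * t \<nu>) sequentially" for i
        unfolding t_def
        by (rule integral_lip_reg_diff[where q = "g i" and Ms = \<mu>\<nu>, OF \<mu> \<mu>\<nu> g_bdd \<theta> tendsto_const[of x]]) blast
      then have "\<forall>i. \<exists>C. C \<ge> 0 \<and> eventually (\<lambda>\<nu>. \<bar>?I (\<mu>\<nu> \<nu>) \<nu> i - ?I \<mu> \<nu> i\<bar> \<le> C * t \<nu>) sequentially"
        by blast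
      from choice[OF this] obtain C where C: "\<And>i. C i \<ge> 0"
        "\<And>i. eventually (\<lambda>\<nu>. \<bar>?I (\<mu>\<nu> \<nu>) \<nu> i - ?I \<mu> \<nu> i\<bar> \<le> C i * t \<nu>) sequentially"
        by auto
      \<comment> \<open>There are finitely many coordinates, so one tail works for all of them;
        comparing the Euclidean with the l1 norm then makes the sum of the \<open>C i\<close> a
        valid constant.\<close>
      have "eventually (\<lambda>\<nu>. \<forall>i. \<bar>?I (\<mu>\<nu> \<nu>) \<nu> i - ?I \<mu> \<nu> i\<bar> \<le> C i * t \<nu>) sequentially"
        using C(2) by (rule eventually_all_finite)
      then have "eventually (\<lambda>\<nu>. norm ((\<integral>\<xi>. G\<nu> \<nu> \<xi> x \<partial>\<mu>) - (\<integral>\<xi>. G\<nu> \<nu> \<xi> x \<partial>\<mu>\<nu> \<nu>))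
          \<le> (\<Sum>i\<in>UNIV. C i) * t \<nu>) sequentially"
      proof eventually_elim
        case (elim \<nu>)
        have "norm ((\<integral>\<xi>. G\<nu> \<nu> \<xi> x \<partial>\<mu>) - (\<integral>\<xi>. G\<nu> \<nu> \<xi> x \<partial>\<mu>\<nu> \<nu>)) \<le> (\<Sum>i\<in>UNIV. \<bar>?I \<mu> \<nu> i - ?I (\<mu>\<nu> \<nu>) \<nu> i\<bar>)"
          using norm_le_l1_cart[of "(\<integral>\<xi>. G\<nu> \<nu> \<xi> x \<partial>\<mu>) - (\<integral>\<xi>. G\<nu> \<nu> \<xi> x \<partial>\<mu>\<nu> \<nu>)"]
          by (simp add: EG\<nu>[OF \<mu>] EG\<nu>[OF \<mu>\<nu>])
        also have "\<dots> \<le> (\<Sum>i\<in>UNIV. C i * t \<nu>)"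
          using elim by (intro sum_mono) (simp add: abs_minus_commute)
        finally show ?case by (simp add: sum_distrib_right)
      qed
      moreover have "(\<Sum>i\<in>UNIV. C i) \<ge> 0"
        using C(1) by (intro sum_nonneg) auto
      ultimately show ?thesis by blast
    qed
  qed

  have f0: "f (0, x) = \<phi> x" for x
    by (simp add: f \<phi> iota_def)
  have f_inf: "f (u, x) = \<infinity>" if "u \<noteq> 0" for u x
    using that g0(1) h(1) by (auto simp: f iota_def proper_def)
  note inf_eq = INF_constrained_eq[of f 0 \<phi>, OF f0 f_inf]
  note eps_eq = eps_argmin_constrained_eq[of f 0 \<phi>, OF f0 f_inf]
  have arg_eq: "argmin f = {0} \<times> argmin \<phi>"
    using eps_eq[of 0] by (simp add: eps_argmin_zero)
  then have arg_f: "argmin f \<noteq> {}"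
    using argmin_\<phi> by auto
  \<comment> \<open>The infimum is finite because it is attained in the domain of
    \<open>\<phi>\<close> and properness keeps \<open>\<phi>\<close> off
    \<open>-\<infinity>\<close>.\<close>
  obtain m where m: "(INF z. f z) = ereal m"
  proof -
    obtain x where x: "\<phi> x < \<infinity>" "\<phi> x = (INF x. \<phi> x)"
      using argmin_\<phi> by (auto simp: argmin_def domain_def)
    have "\<phi> x \<noteq> -\<infinity>"
      using g0(1) h(1) by (auto simp: \<phi> proper_def)
    with x(1) obtain r where "\<phi> x = ereal r"
      by (cases "\<phi> x") auto
    with x(2) inf_eq show thesis
      by (intro that[of r]) simp
  qed
  show ?thesis
  proof (intro conjI)
    show "epi_converges f\<nu> f" by (rule epi)
    show "(INF z. f z) = (INF x. \<phi> x)" by (rule inf_eq)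
    show "\<forall>\<epsilon>\<ge>0. eps_argmin \<epsilon> f = {0} \<times> eps_argmin \<epsilon> \<phi>"
      using eps_eq by blast
    show "limsup (\<lambda>\<nu>. INF z. f\<nu> \<nu> z) \<le> (INF z. f z)"
      by (rule epi_limsup_inf_le[OF epi])
    show "\<forall>\<epsilon>\<nu> \<epsilon>. (\<forall>\<nu>. \<epsilon>\<nu> \<nu> \<ge> 0) \<and> \<epsilon> \<ge> 0 \<and> \<epsilon>\<nu> \<longlonglongrightarrow> \<epsilon>
          \<longrightarrow> LimOut (\<lambda>\<nu>. eps_argmin (\<epsilon>\<nu> \<nu>) (f\<nu> \<nu>)) \<subseteq> eps_argmin \<epsilon> f"
      using epi_LimOut_eps_argmin[OF epi m] by blast
    show "\<forall>\<epsilon>\<nu> N z l. (\<forall>\<nu>. \<epsilon>\<nu> \<nu> \<ge> 0) \<and> \<epsilon>\<nu> \<longlonglongrightarrow> 0 \<and> infinite N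
          \<and> (\<forall>\<nu>\<in>N. z \<nu> \<in> eps_argmin (\<epsilon>\<nu> \<nu>) (f\<nu> \<nu>)) \<and> (z \<longlongrightarrow> l) (along N)
          \<longrightarrow> ((\<lambda>\<nu>. INF z. f\<nu> \<nu> z) \<longlongrightarrow> (INF z. f z)) (along N)"
      using epi_inf_tendsto_along[OF epi m] by blast
    show "(\<lambda>\<nu>. INF z. f\<nu> \<nu> z) \<longlonglongrightarrow> (INF z. f z) \<longleftrightarrow> tight_functions f\<nu>"
      by (rule epi_inf_tendsto_iff_tight[OF epi m arg_f])
    show "(\<lambda>\<nu>. INF z. f\<nu> \<nu> z) \<longlonglongrightarrow> (INF z. f z) \<longrightarrow>
        (\<forall>x0\<in>argmin \<phi>. \<exists>\<epsilon>\<nu>. (\<forall>\<nu>. \<epsilon>\<nu> \<nu> \<ge> 0) \<and> \<epsilon>\<nu> \<longlonglongrightarrow> 0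
            \<and> (0, x0) \<in> LimInn (\<lambda>\<nu>. eps_argmin (\<epsilon>\<nu> \<nu>) (f\<nu> \<nu>)))"
      using epi_LimInn_argmin[OF epi m] arg_eq by simp
    show "(\<lambda>\<nu>. INF z. f\<nu> \<nu> z) \<longlonglongrightarrow> (INF z. f z) \<longrightarrow>
        (\<exists>\<epsilon>\<nu>. (\<forall>\<nu>. \<epsilon>\<nu> \<nu> \<ge> 0) \<and> \<epsilon>\<nu> \<longlonglongrightarrow> 0
            \<and> set_Lim (\<lambda>\<nu>. eps_argmin (\<epsilon>\<nu> \<nu>) (f\<nu> \<nu>)) (argmin f))"
      using epi_Lim_eps_argmin[OF epi m arg_f] by blast
  qed
qed

end
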